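(* Let $\mathbf r(t)$ be a non-planar rational parametric space curve defined on an interval $I$ and let $t_0\in I$ be a parameter that is not the right endpoint of $I$. Then there exists $t_1>t_0$, $t_1\in I$, such that the segment $\mathbf r(t)$, $t\in[t_0,t_1]$, is a quasi-cubic Bézier segment.
   Context: Setting: $\mathbf r(t)=(x(t),y(t),z(t))$ with $x,y,z$ rational functions with real coefficients whose denominators do not vanish on the parameter interval, properly parametrized, and not contained in a plane (curvature $\kappa$ and torsion $\tau$ not identically zero). Here $\kappa=\|\mathbf r'\times\mathbf r''\|/\|\mathbf r'\|^3$ and $\tau$ vanishes exactly where $\det(\mathbf r',\mathbf r'',\mathbf r''')=0$. Unit tangent $\boldsymbol\alpha=\mathbf r'/\|\mathbf r'\|$, unit binormal $\boldsymbol\gamma=\mathbf r'\times\mathbf r''/\|\mathbf r'\times\mathbf r''\|$; at any parameter $s$ one uses the one-sided limits $\boldsymbol\alpha^{\pm}(s)=\lim_{t\to s^\pm}\boldsymbol\alpha(t)$, $\boldsymbol\gamma^{\pm}(s)=\lim_{t\to s^\pm}\boldsymbol\gamma(t)$ (which exist for rational curves); tangent lines $T^{\pm}(s)=\{\mathbf r(s)+\lambda\boldsymbol\alpha^{\pm}(s)\}$, osculating planes $O^{\pm}(s)=\{X:(X-\mathbf r(s))\cdot\boldsymbol\gamma^{\pm}(s)=0\}$ (at ordinary points the $\pm$ versions coincide and are written $O(s)$, $T(s)$). A point is singular if it corresponds to more than one parameter counted with multiplicity. Associated tetrahedron of the segment $[t_0,t_1]$: $\mathbf r_0=\mathbf r(t_0)$,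 $\mathbf r_3=\mathbf r(t_1)$, $L=O^+(t_0)\cap O^-(t_1)$, $\mathbf r_1=T^+(t_0)\cap L$, $\mathbf r_2=T^-(t_1)\cap L$; the tetrahedron $\mathbf r_0\mathbf r_1\mathbf r_2\mathbf r_3$ (requires these intersections to exist and $\mathbf r_1\neq\mathbf r_2$). For $t_0\le a<b\le t_1$ the associated tetrahedron of $[a,b]$ is defined the same way. Parallel point: for a segment lying on one side of a plane $Q$ with both endpoints on $Q$, a point $\mathbf r(t)$, $t$ interior, with $\mathbf r'(t)$ parallel to $Q$. Quasi-cubic Bézier segment: a segment $\mathbf r(t)$, $t\in[t_0,t_1]$, whose associated tetrahedron $\mathbf r_0\mathbf r_1\mathbf r_2\mathbf r_3$ is non-degenerate and which has the following eight properties: (Q1) the one-sided tangent directions at $t_0$ and $t_1$ are parallel to $\mathbf r_0\mathbf r_1$ and $\mathbf r_2\mathbf r_3$; (Q2) the planes $\mathbf r_0\mathbf r_1\mathbf r_2$ and $\mathbf r_1\mathbf r_2\mathbf r_3$ are $O^+(t_0)$ and $O^-(t_1)$; (Q3) $\mathbf r([t_0,t_1])$ lies in the tetrahedron; (Q4) the segment has no singular points and $\kappa(t)\ne0$, $\tau(t)\ne0$ for $t\in(t_0,t_1)$; (Q5) for all $t_0\le a<b\le t_1$ the associated tetrahedron of $[a,b]$ lies in $\mathbf r_0\mathbf r_1\mathbf r_2\mathbf r_3$; (Q6) for $t^\star\in(t_0,t_1)$, $O(t^\star)$ meets the lines $\mathbf r_0\mathbf r_1,\mathbf r_1\mathbf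 r_2,\mathbf r_2\mathbf r_3$ at points $\mathbf r_{01},\mathbf r_{12},\mathbf r_{23}$ and $\|\mathbf r_0\mathbf r_{01}\|,\|\mathbf r_1\mathbf r_{12}\|,\|\mathbf r_2\mathbf r_{23}\|$ are strictly monotone in $t^\star$; (Q7) with $\mathbf r_{03}$ the intersection of the plane $\mathbf r_1\mathbf r_2\mathbf r(t^\star)$ with line $\mathbf r_0\mathbf r_3$ and $\mathbf r_{12}'$ the intersection of the plane $\mathbf r_0\mathbf r_3\mathbf r(t^\star)$ with line $\mathbf r_1\mathbf r_2$, $\|\mathbf r_0\mathbf r_{03}\|$ and $\|\mathbf r_1\mathbf r_{12}'\|$ are strictly monotone in $t^\star\in(t_0,t_1)$; (Q8) there is exactly one parallel point associated to the plane $\mathbf r_0\mathbf r_2\mathbf r_3$ and exactly one associated to the plane $\mathbf r_0\mathbf r_1\mathbf r_3$, and they are the points of the segment at maximal distance from these planes. *)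

theory Defs
  imports "HOL-Analysis.Analysis" "HOL-Computational_Algebra.Polynomial"
begin

definition rat_curve :: "real poly ^ 3 \<Rightarrow> real poly ^ 3 \<Rightarrow> real \<Rightarrow> real ^ 3" where
  "rat_curve p q t = (\<chi> i. poly (p $ i) t / poly (q $ i) t)"

definition rat_curve_c :: "real poly ^ 3 \<Rightarrow> real poly ^ 3 \<Rightarrow> complex \<Rightarrow> 3 \<Rightarrow> complex" where
  "rat_curve_c p q z i = poly (map_poly complex_of_real (p $ i)) z / poly (map_poly complex_of_real (q $ i)) z"

definition defined_at_c :: "real poly ^ 3 \<Rightarrow> complex \<Rightarrow> bool" where
  "defined_at_c q z \<longleftrightarrow> (\<forall>i. poly (map_poly complex_of_real (q $ i)) z \<noteq> 0)"

definition proper_param :: "real poly ^ 3 \<Rightarrow> real poly ^ 3 \<Rightarrow> bool" where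
  "proper_param p q \<longleftrightarrow>
     finite {z. defined_at_c q z \<and>
                (\<exists>w. w \<noteq> z \<and> defined_at_c q w \<and> rat_curve_c p q w = rat_curve_c p q z)}"

definition non_planar :: "(real \<Rightarrow> real ^ 3) \<Rightarrow> real set \<Rightarrow> bool" where
  "non_planar r I \<longleftrightarrow> \<not> (\<exists>n c. n \<noteq> 0 \<and> (\<forall>t\<in>I. n \<bullet> r t = c))"

definition d1 :: "(real \<Rightarrow> real ^ 3) \<Rightarrow> real \<Rightarrow> real ^ 3" where
  "d1 r t = vector_derivative r (at t)"

definition d2 :: "(real \<Rightarrow> real ^ 3) \<Rightarrow> real \<Rightarrow> real ^ 3" where
  "d2 r t = vector_derivative (d1 r) (at t)"

definition d3 :: "(real \<Rightarrow> real ^ 3) \<Rightarrow> real \<Rightarrow> real ^ 3" where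
  "d3 r t = vector_derivative (d2 r) (at t)"

definition curvature :: "(real \<Rightarrow> real ^ 3) \<Rightarrow> real \<Rightarrow> real" where
  "curvature r t = norm (cross3 (d1 r t) (d2 r t)) / norm (d1 r t) ^ 3"

definition torsion :: "(real \<Rightarrow> real ^ 3) \<Rightarrow> real \<Rightarrow> real" where
  "torsion r t = (cross3 (d1 r t) (d2 r t) \<bullet> d3 r t) / norm (cross3 (d1 r t) (d2 r t)) ^ 2"

definition unit_tangent :: "(real \<Rightarrow> real ^ 3) \<Rightarrow> real \<Rightarrow> real ^ 3" where
  "unit_tangent r t = (1 / norm (d1 r t)) *\<^sub>R d1 r t"

definition unit_binormal :: "(real \<Rightarrow> real ^ 3) \<Rightarrow> real \<Rightarrow> real ^ 3" where
  "unit_binormal r t = (1 / norm (cross3 (d1 r t) (d2 r t))) *\<^sub>R cross3 (d1 r t) (d2 r t)"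

definition tangent_plus :: "(real \<Rightarrow> real ^ 3) \<Rightarrow> real \<Rightarrow> real ^ 3" where
  "tangent_plus r s = Lim (at_right s) (unit_tangent r)"

definition tangent_minus :: "(real \<Rightarrow> real ^ 3) \<Rightarrow> real \<Rightarrow> real ^ 3" where
  "tangent_minus r s = Lim (at_left s) (unit_tangent r)"

definition binormal_plus :: "(real \<Rightarrow> real ^ 3) \<Rightarrow> real \<Rightarrow> real ^ 3" where
  "binormal_plus r s = Lim (at_right s) (unit_binormal r)"

definition binormal_minus :: "(real \<Rightarrow> real ^ 3) \<Rightarrow> real \<Rightarrow> real ^ 3" where
  "binormal_minus r s = Lim (at_left s) (unit_binormal r)"

definition tline_plus :: "(real \<Rightarrow> real ^ 3) \<Rightarrow> real \<Rightarrow> (real ^ 3) set" where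
  "tline_plus r s = {r s + c *\<^sub>R tangent_plus r s | c. True}"

definition tline_minus :: "(real \<Rightarrow> real ^ 3) \<Rightarrow> real \<Rightarrow> (real ^ 3) set" where
  "tline_minus r s = {r s + c *\<^sub>R tangent_minus r s | c. True}"

definition osc_plus :: "(real \<Rightarrow> real ^ 3) \<Rightarrow> real \<Rightarrow> (real ^ 3) set" where
  "osc_plus r s = {X. (X - r s) \<bullet> binormal_plus r s = 0}"

definition osc_minus :: "(real \<Rightarrow> real ^ 3) \<Rightarrow> real \<Rightarrow> (real ^ 3) set" where
  "osc_minus r s = {X. (X - r s) \<bullet> binormal_minus r s = 0}"

definition osc :: "(real \<Rightarrow> real ^ 3) \<Rightarrow> real \<Rightarrow> (real ^ 3) set" where
  "osc r s = {X. (X - r s) \<bullet> unit_binormal r s = 0}"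

text \<open>Singular point: r(t) corresponds to more than one parameter of I counted with
 multiplicity (another parameter, or t itself with multiplicity > 1, i.e. r'(t) = 0).\<close>
definition singular_param :: "(real \<Rightarrow> real ^ 3) \<Rightarrow> real set \<Rightarrow> real \<Rightarrow> bool" where
  "singular_param r I t \<longleftrightarrow> (\<exists>s\<in>I. s \<noteq> t \<and> r s = r t) \<or> d1 r t = 0"

definition assoc_tet :: "(real \<Rightarrow> real ^ 3) \<Rightarrow> real \<Rightarrow> real \<Rightarrow>
    real ^ 3 \<Rightarrow> real ^ 3 \<Rightarrow> real ^ 3 \<Rightarrow> real ^ 3 \<Rightarrow> bool" where
  "assoc_tet r a b r0 r1 r2 r3 \<longleftrightarrow>
     r0 = r a \<and> r3 = r b \<and>
     tline_plus r a \<inter> (osc_plus r a \<inter> osc_minus r b) = {r1} \<and>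
     tline_minus r b \<inter> (osc_plus r a \<inter> osc_minus r b) = {r2} \<and>
     r1 \<noteq> r2"

definition parallel_vec :: "real ^ 3 \<Rightarrow> real ^ 3 \<Rightarrow> bool" where
  "parallel_vec u v \<longleftrightarrow> u \<noteq> 0 \<and> v \<noteq> 0 \<and> cross3 u v = 0"

definition strictly_monotone_on :: "real set \<Rightarrow> (real \<Rightarrow> real) \<Rightarrow> bool" where
  "strictly_monotone_on S f \<longleftrightarrow>
     (\<forall>x\<in>S. \<forall>y\<in>S. x < y \<longrightarrow> f x < f y) \<or> (\<forall>x\<in>S. \<forall>y\<in>S. x < y \<longrightarrow> f x > f y)"

definition parallel_to_plane :: "real ^ 3 \<Rightarrow> (real ^ 3) set \<Rightarrow> bool" where
  "parallel_to_plane v Q \<longleftrightarrow> (\<exists>a\<in>Q. a + v \<in> Q)"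

text \<open>Parallel points of the segment [t0,t1] w.r.t. a plane Q (the segment being on
 one side of Q with both endpoints on Q).\<close>
definition parallel_points :: "(real \<Rightarrow> real ^ 3) \<Rightarrow> real \<Rightarrow> real \<Rightarrow> (real ^ 3) set \<Rightarrow> (real ^ 3) set" where
  "parallel_points r t0 t1 Q = {r t | t. t0 < t \<and> t < t1 \<and> parallel_to_plane (d1 r t) Q}"

definition farthest_points :: "(real \<Rightarrow> real ^ 3) \<Rightarrow> real \<Rightarrow> real \<Rightarrow> (real ^ 3) set \<Rightarrow> (real ^ 3) set" where
  "farthest_points r t0 t1 Q =
     {x \<in> r ` {t0..t1}. \<forall>y \<in> r ` {t0..t1}. infdist y Q \<le> infdist x Q}"

definition quasi_cubic :: "(real \<Rightarrow> real ^ 3) \<Rightarrow> real set \<Rightarrow> real \<Rightarrow> real \<Rightarrow> bool" where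
  "quasi_cubic r I t0 t1 \<longleftrightarrow> t0 < t1 \<and>
   (\<exists>r0 r1 r2 r3. assoc_tet r t0 t1 r0 r1 r2 r3 \<and> \<not> coplanar {r0, r1, r2, r3} \<and>
     \<comment> \<open>Q1\<close>
     parallel_vec (tangent_plus r t0) (r1 - r0) \<and> parallel_vec (tangent_minus r t1) (r3 - r2) \<and>
     \<comment> \<open>Q2\<close>
     affine hull {r0, r1, r2} = osc_plus r t0 \<and> affine hull {r1, r2, r3} = osc_minus r t1 \<and>
     \<comment> \<open>Q3\<close>
     r ` {t0..t1} \<subseteq> convex hull {r0, r1, r2, r3} \<and>
     \<comment> \<open>Q4\<close>
     (\<forall>t. t0 < t \<and> t < t1 \<longrightarrow>
        \<not> singular_param r I t \<and> curvature r t \<noteq> 0 \<and> torsion r t \<noteq> 0) \<and>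
     \<comment> \<open>Q5\<close>
     (\<forall>a b. t0 \<le> a \<and> a < b \<and> b \<le> t1 \<longrightarrow>
        (\<exists>s0 s1 s2 s3. assoc_tet r a b s0 s1 s2 s3 \<and>
           convex hull {s0, s1, s2, s3} \<subseteq> convex hull {r0, r1, r2, r3})) \<and>
     \<comment> \<open>Q6\<close>
     (\<exists>p01 p12 p23.
        (\<forall>t. t0 < t \<and> t < t1 \<longrightarrow>
           osc r t \<inter> affine hull {r0, r1} = {p01 t} \<and>
           osc r t \<inter> affine hull {r1, r2} = {p12 t} \<and>
           osc r t \<inter> affine hull {r2, r3} = {p23 t}) \<and>
        strictly_monotone_on {t0<..<t1} (\<lambda>t. dist r0 (p01 t)) \<and>
        strictly_monotone_on {t0<..<t1} (\<lambda>t. dist r1 (p12 t)) \<and>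
        strictly_monotone_on {t0<..<t1} (\<lambda>t. dist r2 (p23 t))) \<and>
     \<comment> \<open>Q7\<close>
     (\<exists>p03 q12.
        (\<forall>t. t0 < t \<and> t < t1 \<longrightarrow>
           \<not> collinear {r1, r2, r t} \<and> \<not> collinear {r0, r3, r t} \<and>
           affine hull {r1, r2, r t} \<inter> affine hull {r0, r3} = {p03 t} \<and>
           affine hull {r0, r3, r t} \<inter> affine hull {r1, r2} = {q12 t}) \<and>
        strictly_monotone_on {t0<..<t1} (\<lambda>t. dist r0 (p03 t)) \<and>
        strictly_monotone_on {t0<..<t1} (\<lambda>t. dist r1 (q12 t))) \<and>
     \<comment> \<open>Q8\<close>
     (\<exists>p. parallel_points r t0 t1 (affine hull {r0, r2, r3}) = {p} \<and>
          farthest_points r t0 t1 (affine hull {r0, r2, r3}) = {p}) \<and>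
     (\<exists>p. parallel_points r t0 t1 (affine hull {r0, r1, r3}) = {p} \<and>
          farthest_points r t0 t1 (affine hull {r0, r1, r3}) = {p}))"

end

theory Submission
  imports Defs
begin

text \<open>At \<open>t0\<close> a non-planar rational curve has a flag in which its three coordinates vanish to
  strictly increasing orders. Dividing their derivatives successively gives a path of unipotent
  upper triangular \<open>4 \<times> 4\<close> matrices, the moving flag of tangent lines and osculating planes, whose
  velocity has superdiagonal entries that are positive on some \<open>(t0, t1)\<close>. Hence the transition
  matrix from the flag at \<open>s\<close> to the flag at \<open>t\<close> is totally positive for \<open>s < t\<close>, and the eight
  properties come down to the signs of its minors and the monotonicity of quotients of two of them,
  whose Wronskian is again an expression of constant sign in minors. Inverting the transition matrix
  exchanges \<open>s\<close> and \<open>t\<close>, so both endpoints are treated at once; the tetrahedron of a subsegment is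
  compared with that of the segment by moving one endpoint at a time. Properness serves only to
  exclude double points.\<close>

section \<open>Derivatives and one-sided limits\<close>

lemma sgn_eq_sgn_diff_of_deriv_pos:
  fixes h h' :: "real \<Rightarrow> real"
  assumes "continuous_on {a..b} h" "s \<in> {a..b}" "h s = 0"
    and has_deriv: "\<And>t. a < t \<Longrightarrow> t < b \<Longrightarrow> (h has_real_derivative h' t) (at t)"
    and deriv_pos: "\<And>t. a < t \<Longrightarrow> t < b \<Longrightarrow> t \<noteq> s \<Longrightarrow> h' t > 0"
    and "t \<in> {a..b}"
  shows "sgn (h t) = sgn (t - s)"
proof (cases t s rule: linorder_cases)
  case less
  have "h t < h s"
    by (rule DERIV_pos_imp_increasing_open[OF less])
      (use assms less in \<open>auto intro!: exI[of _ "h' _"] has_deriv deriv_pos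
        continuous_on_subset[OF assms(1)]\<close>)
  with less \<open>h s = 0\<close> show ?thesis by simp
next
  case greater
  have "h s < h t"
    by (rule DERIV_pos_imp_increasing_open[OF greater])
      (use assms greater in \<open>auto intro!: exI[of _ "h' _"] has_deriv deriv_pos
        continuous_on_subset[OF assms(1)]\<close>)
  with greater \<open>h s = 0\<close> show ?thesis by simp
qed (use assms in auto)

lemma pos_of_sgn_deriv_eq_sgn_diff:
  fixes h h' :: "real \<Rightarrow> real"
  assumes "continuous_on {a..b} h" "s \<in> {a..b}" "h s = 0"
    and has_deriv: "\<And>t. a < t \<Longrightarrow> t < b \<Longrightarrow> (h has_real_derivative h' t) (at t)"
    and sgn_deriv: "\<And>t. a < t \<Longrightarrow> t < b \<Longrightarrow> sgn (h' t) = sgn (t - s)"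
    and "t \<in> {a..b}" "t \<noteq> s"
  shows "h t > 0"
proof (cases t s rule: linorder_cases)
  case less
  have "sgn (h' z) = - 1" if "t < z" "z < s" for z using sgn_deriv[of z] assms that by simp
  then have "h' z < 0" if "t < z" "z < s" for z using that by (simp only: sgn_1_neg)
  then have "h t > h s"
    by (intro DERIV_neg_imp_decreasing_open[OF less])
      (use assms less in \<open>auto intro!: exI[of _ "h' _"] has_deriv
        continuous_on_subset[OF assms(1)]\<close>)
  with \<open>h s = 0\<close> show ?thesis by simp
next
  case greater
  have "sgn (h' z) = 1" if "s < z" "z < t" for z using sgn_deriv[of z] assms that by simp
  then have "h' z > 0" if "s < z" "z < t" for z using that by (simp only: sgn_1_pos)
  then have "h s < h t"
    by (intro DERIV_pos_imp_increasing_open[OF greater])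
      (use assms greater in \<open>auto intro!: exI[of _ "h' _"] has_deriv
        continuous_on_subset[OF assms(1)]\<close>)
  with \<open>h s = 0\<close> show ?thesis by simp
qed (use assms in auto)

lemma divide_less_divide_of_deriv:
  fixes u v u' v' :: "real \<Rightarrow> real"
  assumes "s < t" "continuous_on {s..t} u" "continuous_on {s..t} v"
    and nonzero: "\<And>z. s \<le> z \<Longrightarrow> z \<le> t \<Longrightarrow> v z \<noteq> 0"
    and deriv_u: "\<And>z. s < z \<Longrightarrow> z < t \<Longrightarrow> (u has_real_derivative u' z) (at z)"
    and deriv_v: "\<And>z. s < z \<Longrightarrow> z < t \<Longrightarrow> (v has_real_derivative v' z) (at z)"
    and wronskian: "\<And>z. s < z \<Longrightarrow> z < t \<Longrightarrow> u' z * v z - u z * v' z > 0"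
  shows "u s / v s < u t / v t"
proof (rule DERIV_pos_imp_increasing_open[OF \<open>s < t\<close>, where f = "\<lambda>z. u z / v z"])
  fix z assume interior: "s < z" "z < t"
  have "((\<lambda>z. u z / v z) has_real_derivative (u' z * v z - u z * v' z) / (v z * v z)) (at z)"
    using DERIV_divide[OF deriv_u[OF interior] deriv_v[OF interior]] nonzero[of z] interior by simp
  moreover have "(u' z * v z - u z * v' z) / (v z * v z) > 0"
    using wronskian[OF interior] nonzero[of z] interior
    by (intro divide_pos_pos) (auto simp: zero_less_mult_iff)
  ultimately show "\<exists>y. ((\<lambda>z. u z / v z) has_real_derivative y) (at z) \<and> 0 < y" by blast
qed (use assms in \<open>auto intro!: continuous_on_divide\<close>)

lemma strict_mono_on_divide_of_deriv:
  fixes u v u' v' :: "real \<Rightarrow> real"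
  assumes continuous: "continuous_on {a..b} u" "continuous_on {a..b} v"
    and sgn_quotient: "\<And>t. t \<in> {a..b} \<Longrightarrow> sgn (u t / v t) = sgn (t - s)"
    and deriv_u: "\<And>t. a < t \<Longrightarrow> t < b \<Longrightarrow> (u has_real_derivative u' t) (at t)"
    and deriv_v: "\<And>t. a < t \<Longrightarrow> t < b \<Longrightarrow> (v has_real_derivative v' t) (at t)"
    and wronskian: "\<And>t. a < t \<Longrightarrow> t < b \<Longrightarrow> t \<noteq> s \<Longrightarrow> u' t * v t - u t * v' t > 0"
  shows "strict_mono_on {a..b} (\<lambda>t. u t / v t)"
proof (rule strict_mono_onI)
  fix t1 t2 assume points: "t1 \<in> {a..b}" "t2 \<in> {a..b}" "t1 < t2"
  show "u t1 / v t1 < u t2 / v t2"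
  proof (cases "t1 \<le> s \<and> s \<le> t2")
    case True
    then have "u t1 / v t1 \<le> 0" "0 \<le> u t2 / v t2" "u t1 / v t1 \<noteq> 0 \<or> u t2 / v t2 \<noteq> 0"
      using sgn_quotient[OF points(1)] sgn_quotient[OF points(2)] \<open>t1 < t2\<close>
      by (auto simp: sgn_if split: if_splits)
    then show ?thesis by linarith
  next
    case False
    have "v z \<noteq> 0" if "t1 \<le> z" "z \<le> t2" for z
      using sgn_quotient[of z] that False points by (auto simp: sgn_if split: if_splits)
    then show ?thesis
      by (intro divide_less_divide_of_deriv[OF \<open>t1 < t2\<close>, where u' = u' and v' = v'])
        (use points False deriv_u deriv_v wronskian in
          \<open>auto intro: continuous[THEN continuous_on_subset]\<close>)
  qed
qed

lemma unique_critical_point_strict_max: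
  fixes h h' :: "real \<Rightarrow> real"
  assumes "a < b" and continuous: "continuous_on {a..b} h" and ends: "h a = 0" "h b = 0"
    and pos: "\<And>t. a < t \<Longrightarrow> t < b \<Longrightarrow> h t > 0"
    and has_deriv: "\<And>t. a < t \<Longrightarrow> t < b \<Longrightarrow> (h has_real_derivative h' t) (at t)"
    and zero_unique: "\<And>s t. a < s \<Longrightarrow> s < t \<Longrightarrow> t < b \<Longrightarrow> h' s = 0 \<Longrightarrow> h' t \<noteq> 0"
  shows "\<exists>c. a < c \<and> c < b \<and> (\<forall>t. a < t \<and> t < b \<longrightarrow> (h' t = 0 \<longleftrightarrow> t = c)) \<and>
    (\<forall>t\<in>{a..b}. t \<noteq> c \<longrightarrow> h t < h c)"
proof -
  obtain c where c_mem: "c \<in> {a..b}" and maximal: "\<And>t. t \<in> {a..b} \<Longrightarrow> h t \<le> h c"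
    using continuous_attains_sup[OF compact_Icc _ continuous] \<open>a < b\<close> by auto
  have "h ((a + b) / 2) > 0" using pos \<open>a < b\<close> by simp
  then have max_pos: "h c > 0" using maximal[of "(a + b) / 2"] \<open>a < b\<close> by simp
  have critical: "a < t \<and> t < b \<and> h' t = 0" if maximum: "t \<in> {a..b}" "h t = h c" for t
  proof -
    have interior: "a < t" "t < b" using max_pos maximum ends by (auto simp: less_le)
    moreover have "h' t = 0"
    proof (rule DERIV_local_max[OF has_deriv[OF interior]])
      show "\<forall>z. \<bar>t - z\<bar> < min (t - a) (b - t) \<longrightarrow> h z \<le> h t"
        using maximal maximum by (auto simp: abs_less_iff)
    qed (use interior in auto)
    ultimately show ?thesis by simp
  qed
  have unique: "t = c" if "a < t" "t < b" "h' t = 0" for t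
    using zero_unique[of t c] zero_unique[of c t] critical[OF c_mem refl] that
    by (cases t c rule: linorder_cases) auto
  show ?thesis
  proof (intro exI conjI)
    show "\<forall>t. a < t \<and> t < b \<longrightarrow> (h' t = 0 \<longleftrightarrow> t = c)" using unique critical[OF c_mem refl] by blast
    show "\<forall>t\<in>{a..b}. t \<noteq> c \<longrightarrow> h t < h c" using maximal critical unique by (metis less_le)
  qed (use critical[OF c_mem refl] in auto)
qed

lemma Lim_at_right_continuous_on:
  fixes h k :: "real \<Rightarrow> 'a::t2_space"
  assumes "continuous_on {a..b} h" "a \<le> s" "s < b" "\<And>t. s < t \<Longrightarrow> t < b \<Longrightarrow> k t = h t"
  shows "Lim (at_right s) k = h s"
proof (rule tendsto_Lim)
  have "continuous_on {s..b} h" using assms(1) by (rule continuous_on_subset) (use assms in auto)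
  then have "(h \<longlongrightarrow> h s) (at_right s)" using \<open>s < b\<close> by (rule continuous_on_Icc_at_rightD)
  moreover have "eventually (\<lambda>t. h t = k t) (at_right s)"
    using assms(3,4) by (auto simp: eventually_at_right[OF assms(3)])
  ultimately show "(k \<longlongrightarrow> h s) (at_right s)" by (rule Lim_transform_eventually)
qed simp

lemma Lim_at_left_continuous_on:
  fixes h k :: "real \<Rightarrow> 'a::t2_space"
  assumes "continuous_on {a..b} h" "a < s" "s \<le> b" "\<And>t. a < t \<Longrightarrow> t < s \<Longrightarrow> k t = h t"
  shows "Lim (at_left s) k = h s"
proof (rule tendsto_Lim)
  have "continuous_on {a..s} h" using assms(1) by (rule continuous_on_subset) (use assms in auto)
  then have "(h \<longlongrightarrow> h s) (at_left s)" using \<open>a < s\<close> by (rule continuous_on_Icc_at_leftD)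
  moreover have "eventually (\<lambda>t. h t = k t) (at_left s)"
    using assms(2,4) by (auto simp: eventually_at_left[OF assms(2)])
  ultimately show "(k \<longlongrightarrow> h s) (at_left s)" by (rule Lim_transform_eventually)
qed simp

lemma vector_derivative_cong_open:
  assumes "open S" "t \<in> S" "\<And>s. s \<in> S \<Longrightarrow> h s = k s" "(k has_vector_derivative k') (at t)"
  shows "vector_derivative h (at t) = k'"
  by (rule vector_derivative_at, rule has_vector_derivative_transform_within_open[OF assms(4,1,2)])
    (simp add: assms(3))

section \<open>Hyperplanes and simplices\<close>

definition hyperplane :: "'a::real_inner \<Rightarrow> 'a \<Rightarrow> 'a set" where
  "hyperplane m c = {X. m \<bullet> (X - c) = 0}"

lemma mem_hyperplane: "X \<in> hyperplane m c \<longleftrightarrow> m \<bullet> (X - c) = 0"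
  by (simp add: hyperplane_def)

lemma hyperplane_eq: "hyperplane m c = {X. m \<bullet> X = m \<bullet> c}"
  by (auto simp: hyperplane_def inner_diff_right)

lemma hyperplane_scaleR: "k \<noteq> 0 \<Longrightarrow> hyperplane (k *\<^sub>R m) c = hyperplane m c"
  by (simp add: hyperplane_def)

lemma affine_hull_eq_hyperplane:
  fixes S :: "'a::euclidean_space set"
  assumes "\<not> affine_dependent S" "card S = DIM('a)" "m \<noteq> 0" "S \<subseteq> hyperplane m c"
  shows "affine hull S = hyperplane m c"
proof (rule affine_dim_equal)
  show "affine (hyperplane m c)" unfolding hyperplane_eq by (rule affine_hyperplane)
  then show "affine hull S \<subseteq> hyperplane m c" using assms(4) by (intro hull_minimal)
  show "aff_dim (affine hull S) = aff_dim (hyperplane m c)"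
    using assms(1-3) aff_dim_affine_independent[OF assms(1)] by (simp add: hyperplane_eq)
  show "affine hull S \<noteq> {}" using assms(2) by auto
qed (rule affine_affine_hull)

lemma affine_hull_3_eq_hyperplane:
  fixes u v X m :: "real ^ 3"
  assumes "\<not> collinear {u, v, X}" "m \<noteq> 0" "m \<bullet> (v - u) = 0" "m \<bullet> (X - u) = 0"
  shows "affine hull {u, v, X} = hyperplane m u"
  by (rule affine_hull_eq_hyperplane)
    (use assms in \<open>auto simp: collinear_3_eq_affine_dependent mem_hyperplane\<close>)

lemma hyperplane_Int_affine_hull_2:
  fixes m c u v X :: "'a::real_inner"
  assumes "X \<in> affine hull {u, v}" "X \<in> hyperplane m c" "u \<notin> hyperplane m c"
  shows "hyperplane m c \<inter> affine hull {u, v} = {X}"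
proof -
  have line: "affine hull {u, v} = range (\<lambda>k. u + k *\<^sub>R (v - u))" by (simp add: affine_hull_2_alt)
  obtain k where X_eq: "X = u + k *\<^sub>R (v - u)" using assms(1) unfolding line by auto
  have "m \<bullet> (u + l *\<^sub>R (v - u) - c) = m \<bullet> (u - c) + l * (m \<bullet> (v - u))" for l
    by (simp add: algebra_simps)
  then have mem_iff: "u + l *\<^sub>R (v - u) \<in> hyperplane m c \<longleftrightarrow> l * (m \<bullet> (v - u)) = - (m \<bullet> (u - c))" for l
    by (simp add: mem_hyperplane add_eq_0_iff)
  have "m \<bullet> (v - u) \<noteq> 0" "k * (m \<bullet> (v - u)) = - (m \<bullet> (u - c))"
    using assms(2,3) mem_iff[of k] by (auto simp: X_eq mem_hyperplane)
  then have "u + l *\<^sub>R (v - u) \<in> hyperplane m c \<longleftrightarrow> l = k" for l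
    unfolding mem_iff by (metis mult_cancel_right)
  then show ?thesis unfolding X_eq line by auto
qed

lemma infdist_hyperplane:
  fixes m c X :: "'a::euclidean_space"
  assumes "m \<noteq> 0"
  shows "infdist X (hyperplane m c) = \<bar>m \<bullet> (X - c)\<bar> / norm m"
proof (rule antisym)
  define foot where "foot = X - (m \<bullet> (X - c) / (m \<bullet> m)) *\<^sub>R m"
  have "foot \<in> hyperplane m c" using assms by (simp add: foot_def mem_hyperplane inner_diff_right)
  then have "infdist X (hyperplane m c) \<le> dist X foot" by (rule infdist_le)
  also have "\<dots> = \<bar>m \<bullet> (X - c)\<bar> / norm m"
    by (simp add: foot_def dist_norm power2_norm_eq_inner[symmetric] power2_eq_square)
  finally show "infdist X (hyperplane m c) \<le> \<bar>m \<bullet> (X - c)\<bar> / norm m" .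
next
  have "\<bar>m \<bullet> (X - c)\<bar> / norm m \<le> dist X Z" if "Z \<in> hyperplane m c" for Z
  proof -
    have "m \<bullet> (X - c) = m \<bullet> (X - Z)" using that by (simp add: mem_hyperplane inner_diff_right)
    also have "\<bar>\<dots>\<bar> \<le> norm m * norm (X - Z)" by (rule Cauchy_Schwarz_ineq2)
    finally show ?thesis using assms by (simp add: dist_norm field_simps)
  qed
  moreover have "c \<in> hyperplane m c" by (simp add: mem_hyperplane)
  ultimately show "\<bar>m \<bullet> (X - c)\<bar> / norm m \<le> infdist X (hyperplane m c)"
    by (auto simp: infdist_def intro!: cINF_greatest)
qed

lemma parallel_to_plane_hyperplane: "parallel_to_plane v (hyperplane m c) \<longleftrightarrow> m \<bullet> v = 0"
proof
  assume "parallel_to_plane v (hyperplane m c)"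
  then show "m \<bullet> v = 0"
    by (auto simp: parallel_to_plane_def mem_hyperplane inner_diff_right inner_add_right)
next
  assume "m \<bullet> v = 0"
  then show "parallel_to_plane v (hyperplane m c)"
    by (auto simp: parallel_to_plane_def mem_hyperplane intro!: bexI[of _ c])
qed

lemma affine_independent_if_separating_hyperplanes:
  fixes S :: "'a::euclidean_space set"
  assumes "\<And>v. v \<in> S \<Longrightarrow> \<exists>m c. S - {v} \<subseteq> hyperplane m c \<and> v \<notin> hyperplane m c"
  shows "\<not> affine_dependent S"
proof
  assume "affine_dependent S"
  then obtain v where dependent: "v \<in> S" "v \<in> affine hull (S - {v})"
    unfolding affine_dependent_def by blast
  obtain m c where separating: "S - {v} \<subseteq> hyperplane m c" "v \<notin> hyperplane m c"
    using assms[OF dependent(1)] by blast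
  have "affine hull (S - {v}) \<subseteq> hyperplane m c"
    using separating(1) by (rule hull_minimal) (simp add: hyperplane_eq affine_hyperplane)
  with dependent(2) separating(2) show False by blast
qed

lemma mem_convex_hull_if_facet_halfspaces:
  fixes S :: "'a::euclidean_space set"
  assumes "\<not> affine_dependent S" "card S = Suc (DIM('a))"
    and facet: "\<And>v. v \<in> S \<Longrightarrow>
      \<exists>m c. S - {v} \<subseteq> hyperplane m c \<and> 0 < m \<bullet> (v - c) \<and> 0 \<le> m \<bullet> (X - c)"
  shows "X \<in> convex hull S"
proof -
  have finite_S: "finite S" using assms(1) by (rule aff_independent_finite)
  have "X \<in> affine hull S" using affine_independent_span_eq[OF assms(1,2)] by simp
  then obtain k where barycentric: "sum k S = 1" "(\<Sum>v\<in>S. k v *\<^sub>R v) = X"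
    unfolding affine_hull_finite[OF finite_S] by auto
  have "k v \<ge> 0" if v_mem: "v \<in> S" for v
  proof -
    obtain m c where halfspace: "S - {v} \<subseteq> hyperplane m c" "0 < m \<bullet> (v - c)" "0 \<le> m \<bullet> (X - c)"
      using facet[OF v_mem] by blast
    have "(\<Sum>u\<in>S. k u *\<^sub>R (u - c)) = (\<Sum>u\<in>S. k u *\<^sub>R u) - sum k S *\<^sub>R c"
      by (simp add: scaleR_diff_right sum_subtractf scaleR_left.sum)
    then have "X - c = (\<Sum>u\<in>S. k u *\<^sub>R (u - c))" using barycentric by simp
    then have "m \<bullet> (X - c) = (\<Sum>u\<in>S. k u * (m \<bullet> (u - c)))" by (simp add: inner_sum_right)
    also have "\<dots> = (\<Sum>u\<in>S. if u = v then k v * (m \<bullet> (v - c)) else 0)"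
      using halfspace(1) by (intro sum.cong) (auto simp: mem_hyperplane)
    also have "\<dots> = k v * (m \<bullet> (v - c))" using finite_S v_mem by simp
    finally show ?thesis using halfspace(2,3) by (simp add: zero_le_mult_iff)
  qed
  then show ?thesis using barycentric finite_S by (auto simp: convex_hull_finite)
qed

lemma not_coplanar_if_affine_independent:
  fixes S :: "(real ^ 3) set"
  assumes "\<not> affine_dependent S" "card S = 4"
  shows "\<not> coplanar S"
proof
  assume "coplanar S"
  then obtain u v w where "S \<subseteq> affine hull {u, v, w}" unfolding coplanar_def by blast
  then have "aff_dim S \<le> aff_dim {u, v, w}"
    using aff_dim_subset[of S "affine hull {u, v, w}"] by simp
  also have "\<dots> \<le> int (card {u, v, w}) - 1" by (rule aff_dim_le_card) simp
  also have "\<dots> \<le> 2" by (simp add: card_insert_if)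
  finally show False using aff_dim_affine_independent[OF assms(1)] assms(2) by simp
qed

lemma not_collinear_if_inner:
  fixes u v X m :: "'a::euclidean_space"
  assumes "u \<noteq> v" "m \<bullet> (v - u) = 0" "m \<bullet> (X - u) \<noteq> 0"
  shows "\<not> collinear {u, v, X}"
proof
  assume "collinear {u, v, X}"
  then have "X \<in> affine hull {u, v}" using \<open>u \<noteq> v\<close> collinear_3_affine_hull by blast
  then show False using assms(2,3) by (auto simp: affine_hull_2_alt)
qed

lemma farthest_points_hyperplane:
  assumes "m \<noteq> 0" "u \<in> {a..b}" and nonneg: "\<And>t. t \<in> {a..b} \<Longrightarrow> 0 \<le> m \<bullet> (r t - c)"
    and less: "\<And>t. t \<in> {a..b} \<Longrightarrow> t \<noteq> u \<Longrightarrow> m \<bullet> (r t - c) < m \<bullet> (r u - c)"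
  shows "farthest_points r a b (hyperplane m c) = {r u}"
proof -
  have infdist: "infdist (r t) (hyperplane m c) = m \<bullet> (r t - c) / norm m" if "t \<in> {a..b}" for t
    using nonneg[OF that] by (simp add: infdist_hyperplane[OF assms(1)])
  have less: "infdist (r t) (hyperplane m c) < infdist (r u) (hyperplane m c)"
    if "t \<in> {a..b}" "t \<noteq> u" for t
    using less[OF that] assms(1,2) that(1) by (simp add: infdist divide_strict_right_mono)
  show ?thesis
  proof
    show "{r u} \<subseteq> farthest_points r a b (hyperplane m c)"
      using less assms(2) unfolding farthest_points_def by force
    show "farthest_points r a b (hyperplane m c) \<subseteq> {r u}"
      using less assms(2) unfolding farthest_points_def by (force simp flip: not_less)
  qed
qed

lemma line_sgn_Int:
  fixes u v :: "'a::real_normed_vector"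
  assumes "v \<noteq> 0" and mem_iff: "\<And>c. u + c *\<^sub>R v \<in> S \<longleftrightarrow> c = k"
  shows "{u + c *\<^sub>R sgn v | c. True} \<inter> S = {u + k *\<^sub>R v}"
proof -
  have "u + c *\<^sub>R sgn v = u + (c / norm v) *\<^sub>R v" "u + c *\<^sub>R v = u + (c * norm v) *\<^sub>R sgn v" for c
    using assms(1) by (simp_all add: sgn_div_norm divide_inverse)
  then have "{u + c *\<^sub>R sgn v | c. True} = range (\<lambda>c. u + c *\<^sub>R v)" by blast
  then show ?thesis using mem_iff by auto
qed

section \<open>Division points\<close>

definition divide_point :: "'a::real_vector \<Rightarrow> 'a \<Rightarrow> real \<Rightarrow> real \<Rightarrow> 'a" where
  "divide_point u v \<alpha> \<beta> = u + (\<alpha> / (\<alpha> + \<beta>)) *\<^sub>R (v - u)"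

lemma hyperplane_Int_affine_hull_2_divide_point:
  fixes m c u v :: "'a::real_inner"
  assumes "0 < \<alpha>" "0 < \<beta>" "k \<noteq> 0" "m \<bullet> (u - c) = k * \<alpha>" "m \<bullet> (v - c) = - (k * \<beta>)"
  shows "hyperplane m c \<inter> affine hull {u, v} = {divide_point u v \<alpha> \<beta>}"
proof (rule hyperplane_Int_affine_hull_2)
  show "divide_point u v \<alpha> \<beta> \<in> affine hull {u, v}"
    by (auto simp: divide_point_def affine_hull_2_alt)
  have "m \<bullet> (divide_point u v \<alpha> \<beta> - c) = m \<bullet> (u - c) + \<alpha> / (\<alpha> + \<beta>) * (m \<bullet> (v - c) - m \<bullet> (u - c))"
    by (simp add: divide_point_def algebra_simps)
  also have "\<dots> = 0" unfolding assms(4,5) using assms(1,2) by (simp add: field_simps)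
  finally show "divide_point u v \<alpha> \<beta> \<in> hyperplane m c" by (simp add: mem_hyperplane)
  show "u \<notin> hyperplane m c" using assms by (simp add: mem_hyperplane)
qed

lemma strictly_monotone_dist_divide_point:
  fixes u v :: "real ^ 3"
  assumes "u \<noteq> v" and pos: "\<And>t. t \<in> S \<Longrightarrow> 0 < \<alpha> t" "\<And>t. t \<in> S \<Longrightarrow> 0 < \<beta> t"
    and ratio_less: "\<And>s t. s \<in> S \<Longrightarrow> t \<in> S \<Longrightarrow> s < t \<Longrightarrow> \<alpha> s / \<beta> s < \<alpha> t / \<beta> t"
  shows "strictly_monotone_on S (\<lambda>t. dist u (divide_point u v (\<alpha> t) (\<beta> t)))"
proof -
  have dist_eq: "dist u (divide_point u v (\<alpha> t) (\<beta> t)) = \<alpha> t / (\<alpha> t + \<beta> t) * dist u v"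
    if "t \<in> S" for t
    using pos[OF that] by (simp add: divide_point_def dist_norm norm_minus_commute)
  have "dist u (divide_point u v (\<alpha> s) (\<beta> s)) < dist u (divide_point u v (\<alpha> t) (\<beta> t))"
    if "s \<in> S" "t \<in> S" "s < t" for s t
  proof -
    have "\<alpha> s / (\<alpha> s + \<beta> s) < \<alpha> t / (\<alpha> t + \<beta> t)"
      using ratio_less[OF that] pos[OF that(1)] pos[OF that(2)] by (simp add: field_simps)
    then show ?thesis
      unfolding dist_eq[OF that(1)] dist_eq[OF that(2)]
      by (rule mult_strict_right_mono) (use \<open>u \<noteq> v\<close> in simp)
  qed
  then show ?thesis by (simp add: strictly_monotone_on_def)
qed

lemma plane_through_edge_Int_opposite_edge:
  fixes u v u' v' X \<phi> \<psi> c d :: "real ^ 3"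
  assumes "u \<noteq> v" and facets: "{u, v, u'} \<subseteq> hyperplane \<phi> c" "{u, v, v'} \<subseteq> hyperplane \<psi> d"
    and X_heights: "\<phi> \<bullet> (X - c) = \<alpha> * (\<phi> \<bullet> (v' - c))" "\<psi> \<bullet> (X - d) = \<beta> * (\<psi> \<bullet> (u' - d))"
    and pos: "0 < \<alpha>" "0 < \<beta>" and nonzero: "\<phi> \<bullet> (v' - c) \<noteq> 0" "\<psi> \<bullet> (u' - d) \<noteq> 0"
  shows "\<not> collinear {u, v, X}"
    and "affine hull {u, v, X} \<inter> affine hull {u', v'} = {divide_point u' v' \<alpha> \<beta>}"
proof -
  have inner_\<phi>: "\<phi> \<bullet> (Z - u) = \<phi> \<bullet> (Z - c)" and inner_\<psi>: "\<psi> \<bullet> (Z - u) = \<psi> \<bullet> (Z - d)" for Z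
    using facets by (simp_all add: mem_hyperplane inner_diff_right)
  have edge: "\<phi> \<bullet> (v - c) = 0" "\<psi> \<bullet> (v - d) = 0" "\<phi> \<bullet> (u' - c) = 0" "\<psi> \<bullet> (v' - d) = 0"
    using facets by (simp_all add: mem_hyperplane)
  show noncollinear: "\<not> collinear {u, v, X}"
    using assms(1) edge X_heights(1) pos(1) nonzero(1)
    by (intro not_collinear_if_inner[of _ _ \<phi>]) (simp_all add: inner_\<phi>)
  define m where "m = (\<phi> \<bullet> (X - u)) *\<^sub>R \<psi> - (\<psi> \<bullet> (X - u)) *\<^sub>R \<phi>"
  have m_heights: "m \<bullet> (u' - u) = (\<phi> \<bullet> (v' - c)) * (\<psi> \<bullet> (u' - d)) * \<alpha>"
    "m \<bullet> (v' - u) = - ((\<phi> \<bullet> (v' - c)) * (\<psi> \<bullet> (u' - d)) * \<beta>)"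
    by (simp_all add: m_def inner_diff_left inner_\<phi> inner_\<psi> X_heights edge)
  have "m \<noteq> 0" using m_heights(1) pos nonzero by auto
  then have "affine hull {u, v, X} = hyperplane m u"
    by (intro affine_hull_3_eq_hyperplane noncollinear)
      (simp_all add: m_def inner_diff_left inner_\<phi> inner_\<psi> edge)
  then show "affine hull {u, v, X} \<inter> affine hull {u', v'} = {divide_point u' v' \<alpha> \<beta>}"
    using hyperplane_Int_affine_hull_2_divide_point[OF pos _ m_heights] nonzero by simp
qed

section \<open>Dual bases\<close>

definition dual_vector :: "real ^ 3 \<Rightarrow> real ^ 3 \<Rightarrow> real ^ 3 \<Rightarrow> real ^ 3" where
  "dual_vector u v w = (1 / (cross3 u v \<bullet> w)) *\<^sub>R cross3 v w"

lemma inner_dual_vector: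
  assumes "cross3 u v \<bullet> w \<noteq> 0"
  shows "u \<bullet> dual_vector u v w = 1" "v \<bullet> dual_vector u v w = 0" "w \<bullet> dual_vector u v w = 0"
  using assms cross_triple[of u v w]
  by (simp_all add: dual_vector_def dot_cross_self inner_commute[of u])

lemma cross3_dual_vector:
  assumes "cross3 u v \<bullet> w \<noteq> 0"
  shows "cross3 (dual_vector u v w) (dual_vector v w u) = (1 / (cross3 u v \<bullet> w)) *\<^sub>R w"
  using assms cross_triple[of u v w]
  by (simp add: dual_vector_def cross_mult_left cross_mult_right Lagrange dot_cross_self
    inner_commute)

lemma eq_if_inner_basis_eq:
  assumes "cross3 u v \<bullet> w \<noteq> 0" "u \<bullet> X = u \<bullet> Y" "v \<bullet> X = v \<bullet> Y" "w \<bullet> X = w \<bullet> Y"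
  shows "X = Y"
proof -
  have "u \<bullet> (X - Y) = 0" "v \<bullet> (X - Y) = 0" "w \<bullet> (X - Y) = 0"
    using assms by (simp_all add: inner_diff_right)
  then have "cross3 (X - Y) (cross3 u v) = 0" by (simp add: Lagrange inner_commute)
  then have "(w \<bullet> cross3 u v) *\<^sub>R (X - Y) = 0"
    using Lagrange[of w "X - Y" "cross3 u v"] \<open>w \<bullet> (X - Y) = 0\<close> by simp
  then show ?thesis using assms(1) by (simp add: inner_commute)
qed

section \<open>Positive unipotent paths\<close>

text \<open>The velocity of the path of matrices with rows \<open>(1, x, f, g)\<close>, \<open>(0, 1, y, p)\<close>, \<open>(0, 0, 1, w)\<close>,
  \<open>(0, 0, 0, 1)\<close> is \<open>x'\<close>, \<open>y'\<close>, \<open>w'\<close> times the next row. The derivatives may vanish at the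
  endpoints, where the curve may be singular.\<close>

locale positive_path =
  fixes a b :: real and x y w f p g x' y' w' :: "real \<Rightarrow> real"
  assumes a_less_b: "a < b"
    and continuous: "continuous_on {a..b} x" "continuous_on {a..b} y" "continuous_on {a..b} w"
      "continuous_on {a..b} f" "continuous_on {a..b} p" "continuous_on {a..b} g"
    and has_deriv: "\<And>t. a < t \<Longrightarrow> t < b \<Longrightarrow> (x has_real_derivative x' t) (at t)"
      "\<And>t. a < t \<Longrightarrow> t < b \<Longrightarrow> (y has_real_derivative y' t) (at t)"
      "\<And>t. a < t \<Longrightarrow> t < b \<Longrightarrow> (w has_real_derivative w' t) (at t)"
      "\<And>t. a < t \<Longrightarrow> t < b \<Longrightarrow> (f has_real_derivative y t * x' t) (at t)"
      "\<And>t. a < t \<Longrightarrow> t < b \<Longrightarrow> (p has_real_derivative w t * y' t) (at t)"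
      "\<And>t. a < t \<Longrightarrow> t < b \<Longrightarrow> (g has_real_derivative p t * x' t) (at t)"
    and pos: "\<And>t. a < t \<Longrightarrow> t < b \<Longrightarrow> x' t > 0"
      "\<And>t. a < t \<Longrightarrow> t < b \<Longrightarrow> y' t > 0"
      "\<And>t. a < t \<Longrightarrow> t < b \<Longrightarrow> w' t > 0"
begin

text \<open>The matrix at \<open>t\<close> times the inverse of the matrix at \<open>s\<close> has rows
  \<open>(1, x t - x s, F s t, G s t)\<close>, \<open>(0, 1, y t - y s, P s t)\<close>, \<open>(0, 0, 1, w t - w s)\<close>,
  \<open>(0, 0, 0, 1)\<close>; \<open>Q\<close> and \<open>\<Delta>\<close> are minors of it.\<close>

definition F :: "real \<Rightarrow> real \<Rightarrow> real" where
  "F s t = f t - f s - y s * (x t - x s)"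

definition P :: "real \<Rightarrow> real \<Rightarrow> real" where
  "P s t = p t - p s - w s * (y t - y s)"

definition G :: "real \<Rightarrow> real \<Rightarrow> real" where
  "G s t = g t - g s - p s * (x t - x s) - w s * F s t"

definition Q :: "real \<Rightarrow> real \<Rightarrow> real" where
  "Q s t = (x t - x s) * P s t - G s t"

definition \<Delta> :: "real \<Rightarrow> real \<Rightarrow> real" where
  "\<Delta> s t = F s t * P s t - (y t - y s) * G s t"

lemma relative_self [simp]: "F s s = 0" "P s s = 0" "G s s = 0" "Q s s = 0" "\<Delta> s s = 0"
  by (simp_all add: F_def P_def G_def Q_def \<Delta>_def)

lemma relative_swap:
  "F t s = (x t - x s) * (y t - y s) - F s t"
  "P t s = (y t - y s) * (w t - w s) - P s t"
  "G t s = F s t * (w t - w s) - (x t - x s) * P t s - G s t"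
  "Q t s = G s t - F s t * (w t - w s)"
  "\<Delta> t s = \<Delta> s t"
  by (simp_all add: F_def P_def G_def Q_def \<Delta>_def algebra_simps)

lemma continuous_on_relative:
  "continuous_on {a..b} (F s)" "continuous_on {a..b} (P s)" "continuous_on {a..b} (G s)"
  "continuous_on {a..b} (Q s)" "continuous_on {a..b} (\<Delta> s)"
  "continuous_on {a..b} (\<lambda>t. P t s)" "continuous_on {a..b} (\<lambda>t. G t s)"
  unfolding F_def[abs_def] P_def[abs_def] G_def[abs_def] Q_def[abs_def] \<Delta>_def[abs_def]
  by (intro continuous_intros continuous)+

context
  fixes t :: real
  assumes interior: "a < t" "t < b"
begin

lemma deriv_relative:
  "(F s has_real_derivative x' t * (y t - y s)) (at t)"
  "(P s has_real_derivative y' t * (w t - w s)) (at t)"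
  "(G s has_real_derivative x' t * P s t) (at t)"
  "(Q s has_real_derivative (x t - x s) * (w t - w s) * y' t) (at t)"
  "(\<Delta> s has_real_derivative - Q t s * y' t) (at t)"
  unfolding relative_swap(4)[of t s] F_def[abs_def] P_def[abs_def] G_def[abs_def] Q_def[abs_def]
    \<Delta>_def[abs_def]
  by (auto intro!: derivative_eq_intros has_deriv interior simp: algebra_simps)

lemma deriv_relative_base:
  "((\<lambda>t. P t s) has_real_derivative - (w' t * (y s - y t))) (at t)"
  "((\<lambda>t. G t s) has_real_derivative - (w' t * F t s)) (at t)"
  unfolding F_def P_def G_def
  by (auto intro!: derivative_eq_intros has_deriv interior simp: algebra_simps)

end

lemma sgn_coordinate_diff:
  assumes "s \<in> {a..b}" "t \<in> {a..b}"
  shows "sgn (x t - x s) = sgn (t - s)" "sgn (y t - y s) = sgn (t - s)"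
    "sgn (w t - w s) = sgn (t - s)"
proof -
  have "sgn (h t - h s) = sgn (t - s)"
    if "continuous_on {a..b} h" "\<And>t. a < t \<Longrightarrow> t < b \<Longrightarrow> (h has_real_derivative h' t) (at t)"
      "\<And>t. a < t \<Longrightarrow> t < b \<Longrightarrow> h' t > 0" for h h'
    by (rule sgn_eq_sgn_diff_of_deriv_pos[where h' = h', OF _ assms(1) _ _ _ assms(2)])
      (use that in \<open>auto intro!: continuous_intros derivative_eq_intros\<close>)
  note this[OF continuous(1) has_deriv(1) pos(1)] this[OF continuous(2) has_deriv(2) pos(2)]
    this[OF continuous(3) has_deriv(3) pos(3)]
  then show "sgn (x t - x s) = sgn (t - s)" "sgn (y t - y s) = sgn (t - s)"
    "sgn (w t - w s) = sgn (t - s)"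
    by simp_all
qed

lemma F_pos: "s \<in> {a..b} \<Longrightarrow> t \<in> {a..b} \<Longrightarrow> t \<noteq> s \<Longrightarrow> F s t > 0"
  by (rule pos_of_sgn_deriv_eq_sgn_diff[OF continuous_on_relative(1) _ _ deriv_relative(1)])
    (auto simp: sgn_mult sgn_coordinate_diff pos)

lemma P_pos: "s \<in> {a..b} \<Longrightarrow> t \<in> {a..b} \<Longrightarrow> t \<noteq> s \<Longrightarrow> P s t > 0"
  by (rule pos_of_sgn_deriv_eq_sgn_diff[OF continuous_on_relative(2) _ _ deriv_relative(2)])
    (auto simp: sgn_mult sgn_coordinate_diff pos)

lemma sgn_G: "s \<in> {a..b} \<Longrightarrow> t \<in> {a..b} \<Longrightarrow> sgn (G s t) = sgn (t - s)"
  by (rule sgn_eq_sgn_diff_of_deriv_pos[OF continuous_on_relative(3) _ _ deriv_relative(3)])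
    (auto simp: pos P_pos)

lemma sgn_Q: "s \<in> {a..b} \<Longrightarrow> t \<in> {a..b} \<Longrightarrow> sgn (Q s t) = sgn (t - s)"
proof (rule sgn_eq_sgn_diff_of_deriv_pos[OF continuous_on_relative(4) _ _ deriv_relative(4)])
  fix t assume "s \<in> {a..b}" "a < t" "t < b" "t \<noteq> s"
  then have "sgn ((x t - x s) * (w t - w s) * y' t) = 1"
    by (simp add: sgn_mult sgn_coordinate_diff pos)
  then show "(x t - x s) * (w t - w s) * y' t > 0" by (simp only: sgn_1_pos)
qed auto

lemma \<Delta>_pos: "s \<in> {a..b} \<Longrightarrow> t \<in> {a..b} \<Longrightarrow> t \<noteq> s \<Longrightarrow> \<Delta> s t > 0"
proof (rule pos_of_sgn_deriv_eq_sgn_diff[OF continuous_on_relative(5) _ _ deriv_relative(5)])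
  fix t assume "s \<in> {a..b}" "a < t" "t < b"
  then show "sgn (- Q t s * y' t) = sgn (t - s)"
    using sgn_minus[of "s - t"] by (simp add: sgn_mult sgn_Q pos)
qed auto

text \<open>In the following ratios the junk value \<open>0 / 0 = 0\<close> at \<open>t = s\<close> is the limit.\<close>

lemma strict_mono_on_G_div_F: "s \<in> {a..b} \<Longrightarrow> strict_mono_on {a..b} (\<lambda>t. G s t / F s t)"
proof (rule strict_mono_on_divide_of_deriv[OF continuous_on_relative(3,1) _ deriv_relative(3,1)])
  fix t assume interior: "s \<in> {a..b}" "a < t" "t < b" "t \<noteq> s"
  have "x' t * P s t * F s t - G s t * (x' t * (y t - y s)) = x' t * \<Delta> s t"
    by (simp add: \<Delta>_def algebra_simps)
  with interior show "x' t * P s t * F s t - G s t * (x' t * (y t - y s)) > 0"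
    by (simp add: pos \<Delta>_pos)
next
  fix t assume "s \<in> {a..b}" "t \<in> {a..b}"
  then show "sgn (G s t / F s t) = sgn (t - s)"
    using F_pos[of s t] by (cases "t = s") (simp_all add: sgn_divide sgn_G)
qed

lemma strict_mono_on_P_div_y: "s \<in> {a..b} \<Longrightarrow> strict_mono_on {a..b} (\<lambda>t. P s t / (y t - y s))"
proof (rule strict_mono_on_divide_of_deriv[OF continuous_on_relative(2)])
  fix t assume interior: "s \<in> {a..b}" "a < t" "t < b" "t \<noteq> s"
  have "y' t * (w t - w s) * (y t - y s) - P s t * y' t = y' t * P t s"
    by (simp add: relative_swap(2)[of t s] algebra_simps)
  with interior show "y' t * (w t - w s) * (y t - y s) - P s t * y' t > 0" by (simp add: pos P_pos)
next
  fix t assume "s \<in> {a..b}" "t \<in> {a..b}"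
  then show "sgn (P s t / (y t - y s)) = sgn (t - s)"
    using P_pos[of s t]
    by (cases t s rule: linorder_cases) (simp_all add: sgn_divide sgn_coordinate_diff)
qed (auto intro!: deriv_relative derivative_eq_intros has_deriv continuous_intros continuous)

lemma strict_mono_on_\<Delta>_div_Q: "s \<in> {a..b} \<Longrightarrow> strict_mono_on {a..b} (\<lambda>t. \<Delta> s t / Q s t)"
proof (rule strict_mono_on_divide_of_deriv[OF continuous_on_relative(5,4) _ deriv_relative(5,4)])
  fix t assume interior: "s \<in> {a..b}" "a < t" "t < b" "t \<noteq> s"
  have "- Q t s * y' t * Q s t - \<Delta> s t * ((x t - x s) * (w t - w s) * y' t) =
      y' t * - (G s t * G t s)"
    by (simp add: relative_swap[of t s] Q_def[of s] \<Delta>_def algebra_simps)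
  moreover have "sgn (y' t * - (G s t * G t s)) = 1"
    using interior by (cases t s rule: linorder_cases) (simp_all add: sgn_mult sgn_G pos)
  ultimately show "- Q t s * y' t * Q s t - \<Delta> s t * ((x t - x s) * (w t - w s) * y' t) > 0"
    by (simp only: sgn_1_pos)
next
  fix t assume "s \<in> {a..b}" "t \<in> {a..b}"
  then show "sgn (\<Delta> s t / Q s t) = sgn (t - s)"
    using \<Delta>_pos[of s t] by (cases t s rule: linorder_cases) (simp_all add: sgn_divide sgn_Q)
qed

definition subtangent :: "real \<Rightarrow> real \<Rightarrow> real" where
  "subtangent t s = G t s / P t s"

lemma subtangent_self [simp]: "subtangent s s = 0"
  by (simp add: subtangent_def)

lemma subtangent_less:
  assumes "s \<in> {a..b}" "t \<in> {a..b}" "u \<in> {a..b}" "t < u"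
  shows "subtangent u s < subtangent t s"
proof -
  have "strict_mono_on {a..b} (\<lambda>t. - G t s / P t s)"
  proof (rule strict_mono_on_divide_of_deriv[OF _ continuous_on_relative(6) _ _
        deriv_relative_base(1)])
    fix t assume interior: "a < t" "t < b"
    show "((\<lambda>t. - G t s) has_real_derivative w' t * F t s) (at t)"
      using DERIV_minus[OF deriv_relative_base(2)[OF interior]] by simp
    assume "t \<noteq> s"
    have "w' t * F t s * P t s - - G t s * - (w' t * (y s - y t)) = w' t * \<Delta> t s"
      by (simp add: \<Delta>_def algebra_simps)
    then show "w' t * F t s * P t s - - G t s * - (w' t * (y s - y t)) > 0"
      using interior assms \<open>t \<noteq> s\<close> by (simp add: pos \<Delta>_pos)
  next
    fix t assume "t \<in> {a..b}"
    then show "sgn (- G t s / P t s) = sgn (t - s)"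
      using P_pos[of t s] assms sgn_minus[of "s - t"]
      by (cases "t = s") (simp_all add: sgn_divide sgn_G)
  qed (intro continuous_intros continuous_on_relative)
  then show ?thesis using assms by (auto simp: strict_mono_on_def subtangent_def)
qed

lemma G_pos: "s \<in> {a..b} \<Longrightarrow> t \<in> {a..b} \<Longrightarrow> s < t \<Longrightarrow> G s t > 0"
  using sgn_G[of s t] by (simp add: sgn_1_pos)

lemma G_neg: "s \<in> {a..b} \<Longrightarrow> t \<in> {a..b} \<Longrightarrow> t < s \<Longrightarrow> G s t < 0"
  using sgn_G[of s t] by (simp add: sgn_1_neg)

lemma G_eq_0_iff: "s \<in> {a..b} \<Longrightarrow> t \<in> {a..b} \<Longrightarrow> G s t = 0 \<longleftrightarrow> t = s"
  using sgn_G[of s t] sgn_eq_0_iff[of "G s t"] sgn_eq_0_iff[of "t - s"] by auto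

lemma G_less:
  assumes "s \<in> {a..b}" "t \<in> {a..b}" "u \<in> {a..b}" "t < u" "s \<notin> {t<..<u}"
  shows "G s t < G s u"
proof (rule DERIV_pos_imp_increasing_open[OF \<open>t < u\<close>])
  fix z assume "t < z" "z < u"
  then have "a < z" "z < b" "z \<noteq> s" using assms by auto
  then have "(G s has_real_derivative x' z * P s z) (at z)" "x' z * P s z > 0"
    using assms(1) by (auto intro!: deriv_relative(3) simp: pos P_pos)
  then show "\<exists>l. (G s has_real_derivative l) (at z) \<and> 0 < l" by blast
qed (use assms in \<open>auto intro: continuous_on_subset[OF continuous_on_relative(3)]\<close>)

text \<open>For a curve whose moving flag is the given path, \<open>facet_height s t u\<close> is the height of the
  point at \<open>u\<close> above the plane through the tangent at \<open>s\<close> and the point at \<open>t\<close>, and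
  \<open>osc_height s t u\<close> below is the height, above the osculating plane at \<open>u\<close>, of the point where
  the tangent at \<open>s\<close> meets the osculating plane at \<open>t\<close>.\<close>

definition facet_height :: "real \<Rightarrow> real \<Rightarrow> real \<Rightarrow> real" where
  "facet_height s t u = F s u - F s t / G s t * G s u"

lemma facet_height_endpoints:
  assumes "s \<in> {a..b}" "t \<in> {a..b}" "s \<noteq> t"
  shows "facet_height s t s = 0" "facet_height s t t = 0"
  using assms G_eq_0_iff[of s t] by (simp_all add: facet_height_def)

lemma facet_height_pos:
  assumes "s \<in> {a..b}" "t \<in> {a..b}" "u \<in> open_segment s t"
  shows "facet_height s t u > 0"
proof -
  have between: "s < u \<and> u < t \<or> t < u \<and> u < s" "u \<in> {a..b}"
    using assms by (auto simp: open_segment_eq_real_ivl split: if_splits)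
  then have signs: "F s t > 0" "F s u > 0" "sgn (G s t) = sgn (G s u)"
    using assms by (auto simp: F_pos sgn_G)
  from between(1) show ?thesis
  proof
    assume "s < u \<and> u < t"
    then have "G s u / F s u < G s t / F s t" "G s t > 0"
      using strict_mono_onD[OF strict_mono_on_G_div_F] assms between G_pos by auto
    with signs show ?thesis by (simp add: facet_height_def field_simps)
  next
    assume "t < u \<and> u < s"
    then have "G s t / F s t < G s u / F s u" "G s t < 0"
      using strict_mono_onD[OF strict_mono_on_G_div_F] assms between G_neg by auto
    with signs show ?thesis by (simp add: facet_height_def field_simps)
  qed
qed

lemma deriv_facet_height:
  assumes "a < u" "u < b"
  shows "(facet_height s t has_real_derivative x' u * ((y u - y s) - F s t / G s t * P s u)) (at u)"
  unfolding facet_height_def[abs_def]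
  by (rule DERIV_cong[OF DERIV_diff[OF deriv_relative(1) DERIV_cmult[OF deriv_relative(3)]]])
    (use assms in \<open>auto simp: algebra_simps\<close>)

lemma continuous_on_facet_height: "continuous_on {a..b} (facet_height s t)"
  unfolding facet_height_def[abs_def] by (intro continuous_intros continuous_on_relative)

lemma facet_height_divide_less:
  assumes "a < s" "s < t" "t < b"
  shows "facet_height a b s / facet_height b a s < facet_height a b t / facet_height b a t"
proof (rule divide_less_divide_of_deriv[OF assms(2)])
  fix u assume "s < u" "u < t"
  then have interior: "a < u" "u < b" using assms by auto
  show "(facet_height a b has_real_derivative x' u * ((y u - y a) - F a b / G a b * P a u)) (at u)"
    "(facet_height b a has_real_derivative x' u * ((y u - y b) - F b a / G b a * P b u)) (at u)"
    by (rule deriv_facet_height[OF interior])+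
  have signs: "G a b > 0" "- G b a > 0" "- G u a > 0" "G u b > 0" "F u a > 0" "F u b > 0"
    "\<Delta> a b > 0"
    using interior a_less_b by (simp_all add: G_pos G_neg F_pos \<Delta>_pos)
  have "(x' u * ((y u - y a) - F a b / G a b * P a u) * facet_height b a u -
      facet_height a b u * (x' u * ((y u - y b) - F b a / G b a * P b u))) * (G a b * - G b a) =
    - x' u * ((G a b * (y u - y a) - F a b * P a u) * (G b a * F b u - F b a * G b u)
      - (G a b * F a u - F a b * G a u) * (G b a * (y u - y b) - F b a * P b u))"
    using signs by (simp add: facet_height_def field_simps)
  also have "\<dots> = x' u * (\<Delta> a b * (F u a * G u b + - G u a * F u b))"
    unfolding \<Delta>_def G_def F_def P_def by algebra
  also have "\<dots> > 0" using signs pos(1)[OF interior] by (intro mult_pos_pos add_pos_pos)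
  finally show "x' u * ((y u - y a) - F a b / G a b * P a u) * facet_height b a u -
      facet_height a b u * (x' u * ((y u - y b) - F b a / G b a * P b u)) > 0"
    using mult_pos_pos[OF signs(1,2)] by (simp only: zero_less_mult_pos2)
next
  fix u assume "s \<le> u" "u \<le> t"
  then show "facet_height b a u \<noteq> 0"
    using facet_height_pos[of b a u] assms by (simp add: open_segment_eq_real_ivl)
qed (use assms in \<open>auto intro: continuous_on_subset[OF continuous_on_facet_height]\<close>)

definition osc_height :: "real \<Rightarrow> real \<Rightarrow> real \<Rightarrow> real" where
  "osc_height s t u = G u s - subtangent t s * P u s"

lemma osc_height_eq:
  assumes "s \<in> {a..b}" "u \<in> {a..b}" "s \<noteq> u"
  shows "osc_height s t u = P u s * (subtangent u s - subtangent t s)"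
  using P_pos[of u s] assms by (simp add: osc_height_def subtangent_def right_diff_distrib)

lemma osc_height_pos:
  assumes "s \<in> {a..b}" "t \<in> {a..b}" "u \<in> {a..b}" "s \<noteq> u" "u < t"
  shows "osc_height s t u > 0"
  using assms by (simp add: osc_height_eq P_pos subtangent_less)

lemma osc_height_neg:
  assumes "s \<in> {a..b}" "t \<in> {a..b}" "u \<in> {a..b}" "s \<noteq> u" "t < u"
  shows "osc_height s t u < 0"
  using assms by (simp add: osc_height_eq P_pos subtangent_less mult_pos_neg)

lemma deriv_osc_height:
  assumes "a < u" "u < b"
  shows "(osc_height s t has_real_derivative
    - (w' u * (F u s - subtangent t s * (y s - y u)))) (at u)"
  unfolding osc_height_def[abs_def]
  by (auto intro!: derivative_eq_intros deriv_relative_base[OF assms] simp: algebra_simps)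

lemma continuous_on_osc_height: "continuous_on {a..b} (osc_height s t)"
  unfolding osc_height_def[abs_def] by (intro continuous_intros continuous_on_relative)

lemma osc_height_divide_less:
  assumes "a < s" "s < t" "t < b"
  shows "osc_height a b s / - osc_height b a s < osc_height a b t / - osc_height b a t"
proof (rule divide_less_divide_of_deriv[OF assms(2)])
  fix u assume "s < u" "u < t"
  then have interior: "a < u" "u < b" using assms by auto
  show "(osc_height a b has_real_derivative
      - (w' u * (F u a - subtangent b a * (y a - y u)))) (at u)"
    "((\<lambda>u. - osc_height b a u) has_real_derivative
      w' u * (F u b - subtangent a b * (y b - y u))) (at u)"
    using deriv_osc_height[OF interior, of a b]
      DERIV_minus[OF deriv_osc_height[OF interior, of b a]] by simp_all
  have signs: "P a b > 0" "P b a > 0" "G a u > 0" "- G b u > 0" "P a u > 0" "P b u > 0" "\<Delta> a b > 0"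
    using interior a_less_b by (simp_all add: G_pos G_neg P_pos \<Delta>_pos)
  have "(- (w' u * (F u a - subtangent b a * (y a - y u))) * - osc_height b a u -
      osc_height a b u * (w' u * (F u b - subtangent a b * (y b - y u)))) * (P b a * P a b) =
    w' u * ((P b a * F u a - G b a * (y a - y u)) * (P a b * G u b - G a b * P u b)
   - (P b a * G u a - G b a * P u a) * (P a b * F u b - G a b * (y b - y u)))"
    using signs by (simp add: osc_height_def subtangent_def field_simps)
  also have "\<dots> = w' u * (\<Delta> a b * (P b u * G a u + - G b u * P a u))"
    unfolding \<Delta>_def G_def F_def P_def by algebra
  also have "\<dots> > 0" using signs pos(3)[OF interior] by (intro mult_pos_pos add_pos_pos)
  finally show "- (w' u * (F u a - subtangent b a * (y a - y u))) * - osc_height b a u -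
      osc_height a b u * (w' u * (F u b - subtangent a b * (y b - y u))) > 0"
    using mult_pos_pos[OF signs(2,1)] by (simp only: zero_less_mult_pos2)
next
  fix u assume "s \<le> u" "u \<le> t"
  then show "- osc_height b a u \<noteq> 0" using osc_height_neg[of b a u] assms by simp
qed (use assms in \<open>auto intro!: continuous_on_minus
    intro: continuous_on_subset[OF continuous_on_osc_height]\<close>)

lemma deriv_facet_height_unique_zero:
  assumes "{s, t} = {a, b}" "a < u" "u < v" "v < b"
    "(y u - y s) - F s t / G s t * P s u = 0"
  shows "(y v - y s) - F s t / G s t * P s v \<noteq> 0"
proof
  assume "(y v - y s) - F s t / G s t * P s v = 0"
  have distinct: "s \<in> {a..b}" "u \<noteq> s" "v \<noteq> s" using assms by (auto simp: doubleton_eq_iff)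
  have "P s z / (y z - y s) = G s t / F s t"
    if "y z - y s - F s t / G s t * P s z = 0" "z \<in> {a..b}" "z \<noteq> s" for z
    using that P_pos[of s z] distinct sgn_coordinate_diff(2)[of s z] by (auto simp: field_simps)
  then show False
    using strict_mono_onD[OF strict_mono_on_P_div_y[OF distinct(1)], of u v] assms distinct
      \<open>y v - y s - _ = 0\<close> by auto
qed

end

section \<open>The associated tetrahedron\<close>

locale flag_curve = positive_path a b x y w f p g x' y' w'
  for a b x y w f p g x' y' w' +
  fixes r :: "real \<Rightarrow> real ^ 3" and n1 n2 n3 :: "real ^ 3"
  assumes independent: "cross3 n1 n2 \<bullet> n3 \<noteq> 0"
    and coordinates: "n1 \<bullet> (r t - r s) = x t - x s" "n2 \<bullet> (r t - r s) = f t - f s"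
      "n3 \<bullet> (r t - r s) = g t - g s"
begin

lemma independent_cyclic: "cross3 n2 n3 \<bullet> n1 \<noteq> 0" "cross3 n3 n1 \<bullet> n2 \<noteq> 0"
  using independent cross_triple[of n1 n2 n3] cross_triple[of n3 n1 n2] by auto

lemmas inner_dual_basis = inner_dual_vector[OF independent]
  inner_dual_vector[OF independent_cyclic(1)] inner_dual_vector[OF independent_cyclic(2)]

abbreviation e1 :: "real ^ 3" where
  "e1 \<equiv> dual_vector n1 n2 n3"

abbreviation e2 :: "real ^ 3" where
  "e2 \<equiv> dual_vector n2 n3 n1"

abbreviation e3 :: "real ^ 3" where
  "e3 \<equiv> dual_vector n3 n1 n2"

text \<open>The bases \<open>tangent t\<close>, \<open>normal t\<close>, \<open>e3\<close> and \<open>n1\<close>, \<open>rect_normal t\<close>, \<open>osc_normal t\<close> are dual.\<close>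

definition tangent :: "real \<Rightarrow> real ^ 3" where
  "tangent t = e1 + y t *\<^sub>R e2 + p t *\<^sub>R e3"

definition normal :: "real \<Rightarrow> real ^ 3" where
  "normal t = e2 + w t *\<^sub>R e3"

definition rect_normal :: "real \<Rightarrow> real ^ 3" where
  "rect_normal t = n2 - y t *\<^sub>R n1"

definition osc_normal :: "real \<Rightarrow> real ^ 3" where
  "osc_normal t = n3 - w t *\<^sub>R n2 + (y t * w t - p t) *\<^sub>R n1"

lemma inner_tangent: "n1 \<bullet> tangent t = 1" "n2 \<bullet> tangent t = y t" "n3 \<bullet> tangent t = p t"
  by (simp_all add: tangent_def inner_add_right inner_dual_basis)

lemma inner_normal: "n1 \<bullet> normal t = 0" "n2 \<bullet> normal t = 1" "n3 \<bullet> normal t = w t"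
  by (simp_all add: normal_def inner_add_right inner_dual_basis)

lemma inner_rect_normal:
  "rect_normal s \<bullet> tangent t = y t - y s"
  "rect_normal s \<bullet> (r t - r s) = F s t"
  unfolding rect_normal_def F_def inner_diff_left inner_scaleR_left inner_tangent coordinates
  by simp_all

lemma inner_osc_normal:
  "osc_normal s \<bullet> tangent t = P s t" "osc_normal s \<bullet> normal t = w t - w s"
  "osc_normal s \<bullet> e3 = 1" "osc_normal s \<bullet> (r t - r s) = G s t"
  unfolding osc_normal_def F_def P_def G_def inner_add_left inner_diff_left inner_scaleR_left
    inner_tangent inner_normal inner_dual_basis coordinates
  by (simp_all add: algebra_simps)

lemma tangent_nonzero: "tangent t \<noteq> 0"
  using inner_tangent(1)[of t] by auto

lemma osc_normal_nonzero: "osc_normal t \<noteq> 0"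
  using inner_osc_normal(3)[of t] by auto

lemma cross3_tangent_normal:
  "cross3 (tangent t) (normal t) = (1 / (cross3 n1 n2 \<bullet> n3)) *\<^sub>R osc_normal t"
proof -
  have "cross3 e1 e2 = (1 / (cross3 n1 n2 \<bullet> n3)) *\<^sub>R n3"
    "cross3 e2 e3 = (1 / (cross3 n1 n2 \<bullet> n3)) *\<^sub>R n1"
    "cross3 e3 e1 = (1 / (cross3 n1 n2 \<bullet> n3)) *\<^sub>R n2"
    using cross3_dual_vector[OF independent] cross3_dual_vector[OF independent_cyclic(1)]
      cross3_dual_vector[OF independent_cyclic(2)] cross_triple[of n1 n2 n3]
      cross_triple[of n3 n1 n2]
    by simp_all
  then show ?thesis
    using cross_skew[of e3 e2] cross_skew[of e1 e3]
    by (simp add: tangent_def normal_def osc_normal_def cross_add_left cross_add_right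
        cross_mult_left cross_mult_right algebra_simps)
qed

text \<open>The tangent at \<open>s\<close> meets the osculating plane at \<open>t\<close> in \<open>vertex s t\<close>.\<close>

definition vertex :: "real \<Rightarrow> real \<Rightarrow> real ^ 3" where
  "vertex s t = r s - subtangent t s *\<^sub>R tangent s"

definition tet :: "real \<Rightarrow> real \<Rightarrow> (real ^ 3) set" where
  "tet s t = {r s, vertex s t, vertex t s, r t}"

definition facet_normal :: "real \<Rightarrow> real \<Rightarrow> real ^ 3" where
  "facet_normal s t = rect_normal s - (F s t / G s t) *\<^sub>R osc_normal s"

lemma vertex_self: "vertex s s = r s"
  by (simp add: vertex_def)

lemma tet_commute: "tet s t = tet t s"
  by (auto simp: tet_def)

lemma inner_osc_normal_vertex: "osc_normal u \<bullet> (vertex s t - r u) = osc_height s t u"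
proof -
  have "vertex s t - r u = (r s - r u) - subtangent t s *\<^sub>R tangent s" by (simp add: vertex_def)
  then show ?thesis
    by (simp only: osc_height_def inner_diff_right[of _ "r s - r u"] inner_scaleR_right
      inner_osc_normal)
qed

lemma inner_facet_normal:
  "facet_normal s t \<bullet> tangent u = (y u - y s) - F s t / G s t * P s u"
  "facet_normal s t \<bullet> (r u - r s) = facet_height s t u"
  unfolding facet_normal_def inner_diff_left inner_scaleR_left inner_rect_normal inner_osc_normal
    facet_height_def by simp_all

lemma inner_vertex:
  assumes "s \<in> {a..b}" "u \<in> {a..b}" "u \<noteq> s"
  shows "n1 \<bullet> (vertex u s - r s) = Q s u / P s u"
    "rect_normal s \<bullet> (vertex u s - r s) = \<Delta> s u / P s u"
    "osc_normal s \<bullet> (vertex u s - r s) = 0"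
proof -
  have positive: "P s u > 0" using assms by (rule P_pos)
  have inner: "m \<bullet> (vertex u s - r s) = m \<bullet> (r u - r s) - subtangent s u * (m \<bullet> tangent u)" for m
    by (simp add: vertex_def algebra_simps)
  show "n1 \<bullet> (vertex u s - r s) = Q s u / P s u"
    "rect_normal s \<bullet> (vertex u s - r s) = \<Delta> s u / P s u"
    "osc_normal s \<bullet> (vertex u s - r s) = 0"
    unfolding inner inner_tangent inner_rect_normal inner_osc_normal coordinates using positive
    by (simp_all add: Q_def \<Delta>_def subtangent_def field_simps)
qed

lemma inner_facet_normal_vertex:
  "s \<in> {a..b} \<Longrightarrow> u \<in> {a..b} \<Longrightarrow> u \<noteq> s \<Longrightarrow> facet_normal s t \<bullet> (vertex u s - r s) = \<Delta> s u / P s u"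
  by (simp add: facet_normal_def inner_diff_left inner_vertex)

definition facets :: "real \<Rightarrow> real \<Rightarrow> ((real ^ 3) \<times> (real ^ 3)) set" where
  "facets s t = {(G t s *\<^sub>R osc_normal t, r t), (G s t *\<^sub>R osc_normal s, r s),
     (facet_normal s t, r s), (facet_normal t s, r t)}"

lemma facets_commute: "facets s t = facets t s"
  by (auto simp: facets_def)

context
  fixes s t :: real
  assumes params: "s \<in> {a..b}" "t \<in> {a..b}" "s \<noteq> t"
begin

lemma osculating_facet: "{vertex s t, vertex t s, r t} \<subseteq> hyperplane (osc_normal t) (r t)"
  using params
  by (simp add: mem_hyperplane inner_osc_normal_vertex osc_height_eq) (simp add: osc_height_def)

lemma tangent_facet: "{r s, vertex s t, r t} \<subseteq> hyperplane (facet_normal s t) (r s)"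
  using params by (auto simp: mem_hyperplane inner_facet_normal facet_height_endpoints vertex_def)

lemma facet_normal_pos:
  "0 < (G t s *\<^sub>R osc_normal t) \<bullet> (r s - r t)"
  "0 < facet_normal s t \<bullet> (vertex t s - r s)"
  using params G_eq_0_iff[of t s]
  by (auto simp: inner_osc_normal inner_facet_normal_vertex P_pos \<Delta>_pos zero_less_mult_iff)

end

lemma tet_distinct:
  assumes "s \<in> {a..b}" "t \<in> {a..b}" "s \<noteq> t"
  shows "distinct [r s, vertex s t, vertex t s, r t]"
  using osculating_facet[OF assms] osculating_facet[of t s] tangent_facet[of t s]
    facet_normal_pos[OF assms] facet_normal_pos[of t s] assms
  by (auto simp: mem_hyperplane)

lemma card_tet: "s \<in> {a..b} \<Longrightarrow> t \<in> {a..b} \<Longrightarrow> s \<noteq> t \<Longrightarrow> card (tet s t) = 4"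
  using tet_distinct[of s t] by (simp add: tet_def)

lemma facet_opposite:
  assumes "s \<in> {a..b}" "t \<in> {a..b}" "s \<noteq> t" "v \<in> tet s t"
  shows "\<exists>(m, c) \<in> facets s t. tet s t - {v} \<subseteq> hyperplane m c \<and> 0 < m \<bullet> (v - c)"
proof -
  have "\<exists>(m, c) \<in> facets s t. tet s t - {v} \<subseteq> hyperplane m c \<and> 0 < m \<bullet> (v - c)"
    if "s \<in> {a..b}" "t \<in> {a..b}" "s \<noteq> t" "v = r s \<or> v = vertex t s" for s t
    using that(4)
  proof
    assume "v = r s"
    then show ?thesis
      using osculating_facet[OF that(1-3)] facet_normal_pos(1)[OF that(1-3)] G_eq_0_iff[of t s]
        that(1-3)
      by (intro bexI[of _ "(G t s *\<^sub>R osc_normal t, r t)"])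
        (auto simp: tet_def facets_def hyperplane_scaleR)
  next
    assume "v = vertex t s"
    then show ?thesis
      using tangent_facet[OF that(1-3)] facet_normal_pos(2)[OF that(1-3)]
      by (intro bexI[of _ "(facet_normal s t, r s)"]) (auto simp: tet_def facets_def)
  qed
  note this[OF assms(1-3)] this[OF assms(2,1) assms(3)[symmetric]]
  then show ?thesis
    using assms(4) by (auto simp: tet_commute[of t s] facets_commute[of t s] tet_def[of s t])
qed

lemma tet_affine_independent:
  assumes "s \<in> {a..b}" "t \<in> {a..b}" "s \<noteq> t"
  shows "\<not> affine_dependent (tet s t)"
proof (rule affine_independent_if_separating_hyperplanes)
  fix v assume "v \<in> tet s t"
  then show "\<exists>m c. tet s t - {v} \<subseteq> hyperplane m c \<and> v \<notin> hyperplane m c"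
    using facet_opposite[OF assms] by (fastforce simp: mem_hyperplane)
qed

lemma mem_convex_hull_tet:
  assumes "s \<in> {a..b}" "t \<in> {a..b}" "s \<noteq> t" "\<And>m c. (m, c) \<in> facets s t \<Longrightarrow> 0 \<le> m \<bullet> (X - c)"
  shows "X \<in> convex hull (tet s t)"
proof (rule mem_convex_hull_if_facet_halfspaces)
  fix v assume "v \<in> tet s t"
  then show "\<exists>m c. tet s t - {v} \<subseteq> hyperplane m c \<and> 0 < m \<bullet> (v - c) \<and> 0 \<le> m \<bullet> (X - c)"
    using facet_opposite[OF assms(1-3)] assms(4) by fastforce
qed (use assms in \<open>simp_all add: tet_affine_independent card_tet\<close>)

lemma tet_not_coplanar: "s \<in> {a..b} \<Longrightarrow> t \<in> {a..b} \<Longrightarrow> s \<noteq> t \<Longrightarrow> \<not> coplanar (tet s t)"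
  by (simp add: not_coplanar_if_affine_independent tet_affine_independent card_tet)

lemma affine_hull_facet:
  assumes "s \<in> {a..b}" "t \<in> {a..b}" "s \<noteq> t"
  shows "affine hull {vertex s t, vertex t s, r t} = hyperplane (osc_normal t) (r t)"
    "affine hull {r s, vertex s t, r t} = hyperplane (facet_normal s t) (r s)"
proof -
  have independent: "\<not> affine_dependent S" if "S \<subseteq> tet s t" for S
    using affine_independent_subset[OF tet_affine_independent[OF assms] that] .
  show "affine hull {vertex s t, vertex t s, r t} = hyperplane (osc_normal t) (r t)"
    using tet_distinct[OF assms]
    by (intro affine_hull_eq_hyperplane independent osc_normal_nonzero osculating_facet assms)
      (auto simp: tet_def)
  have "facet_normal s t \<noteq> 0" using facet_normal_pos(2)[OF assms] by auto
  then show "affine hull {r s, vertex s t, r t} = hyperplane (facet_normal s t) (r s)"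
    using tet_distinct[OF assms]
    by (intro affine_hull_eq_hyperplane independent tangent_facet assms) (auto simp: tet_def)
qed

lemma curve_mem_tet:
  assumes "s \<in> {a..b}" "t \<in> {a..b}" "u \<in> closed_segment s t"
  shows "r u \<in> convex hull (tet s t)"
proof (cases "u = s \<or> u = t")
  case False
  then have segment: "u \<in> open_segment s t" using assms(3) by (simp add: open_segment_def)
  then have between: "u \<in> {a..b}" "sgn (u - t) = sgn (s - t)" "sgn (u - s) = sgn (t - s)" "s \<noteq> t"
    using assms by (auto simp: open_segment_eq_real_ivl split: if_splits)
  then have "G t s * G t u \<ge> 0" "G s t * G s u \<ge> 0"
    using sgn_G[of t s] sgn_G[of t u] sgn_G[of s t] sgn_G[of s u] assms
    by (auto simp: zero_le_mult_iff sgn_if split: if_splits)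
  moreover have "facet_height s t u > 0" "facet_height t s u > 0"
    using assms segment facet_height_pos[of s t u] facet_height_pos[of t s u]
    by (auto simp: open_segment_commute)
  ultimately show ?thesis
    by (intro mem_convex_hull_tet[OF assms(1,2) \<open>s \<noteq> t\<close>])
      (auto simp: facets_def inner_osc_normal inner_facet_normal)
qed (auto simp: tet_def intro: hull_inc)

lemma vertex_same_base_mem_tet:
  assumes "s \<in> {a..b}" "t \<in> {a..b}" "u \<in> open_segment s t"
  shows "vertex s u \<in> convex hull (tet s t)"
proof -
  define k where "k = subtangent u s / subtangent t s"
  have "s < u \<and> u < t \<or> t < u \<and> u < s"
    using assms(3) by (auto simp: open_segment_eq_real_ivl split: if_splits)
  then have ratio: "0 \<le> k" "k \<le> 1" "subtangent u s = k * subtangent t s"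
    using subtangent_less[of s s u] subtangent_less[of s u t] subtangent_less[of s t u]
      subtangent_less[of s u s] assms(1,2)
    by (auto simp: k_def zero_le_divide_iff divide_le_eq)
  have "vertex s u = (1 - k) *\<^sub>R r s + k *\<^sub>R vertex s t"
    by (simp add: vertex_def ratio(3) algebra_simps)
  also have "\<dots> \<in> convex hull (tet s t)"
    by (rule convexD[OF convex_convex_hull]) (use ratio in \<open>auto simp: tet_def intro: hull_inc\<close>)
  finally show ?thesis .
qed

lemma facet_normal_swap:
  assumes "G t s \<noteq> 0"
  shows "G t s *\<^sub>R facet_normal t s = Q s t *\<^sub>R rect_normal s - \<Delta> s t *\<^sub>R n1 - F t s *\<^sub>R osc_normal s"
proof -
  have "G t s *\<^sub>R facet_normal t s = (G t s + F t s * w t) *\<^sub>R n2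
      - (G t s * y t + F t s * (y t * w t - p t)) *\<^sub>R n1 - F t s *\<^sub>R n3"
    using assms by (simp add: facet_normal_def rect_normal_def osc_normal_def algebra_simps)
  also have "G t s + F t s * w t = Q s t + F t s * w s"
    by (simp add: relative_swap(4)[of s t] algebra_simps)
  also have "G t s * y t + F t s * (y t * w t - p t) =
      Q s t * y s + \<Delta> s t + F t s * (y s * w s - p s)"
    unfolding Q_def \<Delta>_def G_def P_def F_def by algebra
  finally show ?thesis by (simp add: rect_normal_def osc_normal_def algebra_simps)
qed

lemma inner_facet_normal_vertex_swapped:
  assumes "s \<in> {a..b}" "t \<in> {a..b}" "u \<in> {a..b}" "s \<noteq> t" "u \<noteq> s"
  shows "facet_normal t s \<bullet> (vertex u s - r t) = (Q s t * \<Delta> s u - \<Delta> s t * Q s u) / (P s u * G t s)"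
proof -
  have G_nonzero: "G t s \<noteq> 0" using assms by (simp add: G_eq_0_iff)
  have "facet_normal t s \<bullet> (r s - r t) = 0"
    using assms by (simp add: inner_facet_normal facet_height_endpoints)
  then have "facet_normal t s \<bullet> (vertex u s - r t) = facet_normal t s \<bullet> (vertex u s - r s)"
    by (simp add: inner_diff_right)
  moreover have "(G t s *\<^sub>R facet_normal t s) \<bullet> (vertex u s - r s) =
      Q s t * (\<Delta> s u / P s u) - \<Delta> s t * (Q s u / P s u)"
    unfolding facet_normal_swap[OF G_nonzero] using assms
    by (simp add: inner_diff_left inner_vertex)
  ultimately show ?thesis using G_nonzero P_pos[of s u] assms by (simp add: field_simps)
qed

lemma vertex_swapped_base_mem_tet:
  assumes "s \<in> {a..b}" "t \<in> {a..b}" "u \<in> open_segment s t"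
  shows "vertex u s \<in> convex hull (tet s t)"
proof (rule mem_convex_hull_tet[OF assms(1,2)])
  have between: "s < u \<and> u < t \<or> t < u \<and> u < s"
    using assms(3) by (auto simp: open_segment_eq_real_ivl split: if_splits)
  then have interior: "u \<in> {a..b}" "u \<noteq> s" "u \<noteq> t" using assms(1,2) by auto
  show "s \<noteq> t" using assms(3) by auto
  have "0 \<le> G t s * osc_height u s t"
    using between G_neg[of t s] osc_height_neg[of u s t] G_pos[of t s] osc_height_pos[of u s t]
      assms interior
    by (auto simp: zero_le_mult_iff)
  moreover have "osc_height u s s = 0" using assms interior by (simp add: osc_height_eq)
  moreover have "0 < \<Delta> s u / P s u" using assms interior by (simp add: P_pos \<Delta>_pos)
  moreover have "0 \<le> (Q s t * \<Delta> s u - \<Delta> s t * Q s u) / (P s u * G t s)"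
    using between
  proof
    assume "s < u \<and> u < t"
    then have "\<Delta> s u / Q s u < \<Delta> s t / Q s t" "Q s u > 0" "Q s t > 0" "G t s < 0" "P s u > 0"
      using strict_mono_onD[OF strict_mono_on_\<Delta>_div_Q] sgn_Q[of s u] sgn_Q[of s t] assms interior
      by (auto simp: sgn_1_pos G_neg P_pos)
    then have "Q s t * \<Delta> s u - \<Delta> s t * Q s u \<le> 0" "P s u * G t s \<le> 0"
      by (simp_all add: field_simps mult_nonneg_nonpos)
    then show ?thesis by (rule divide_nonpos_nonpos)
  next
    assume "t < u \<and> u < s"
    then have "\<Delta> s t / Q s t < \<Delta> s u / Q s u" "Q s u < 0" "Q s t < 0" "G t s > 0" "P s u > 0"
      using strict_mono_onD[OF strict_mono_on_\<Delta>_div_Q] sgn_Q[of s u] sgn_Q[of s t] assms interior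
      by (auto simp: sgn_1_neg G_pos P_pos)
    then have "0 \<le> Q s t * \<Delta> s u - \<Delta> s t * Q s u" "0 \<le> P s u * G t s"
      by (simp_all add: field_simps)
    then show ?thesis by (rule divide_nonneg_nonneg)
  qed
  ultimately show "0 \<le> m \<bullet> (vertex u s - c)" if "(m, c) \<in> facets s t" for m c
    using that assms interior \<open>s \<noteq> t\<close>
    by (auto simp: facets_def inner_osc_normal_vertex inner_facet_normal_vertex
      inner_facet_normal_vertex_swapped)
qed

lemma tet_mono:
  assumes "s \<in> {a..b}" "t \<in> {a..b}" "u \<in> open_segment s t"
  shows "convex hull (tet s u) \<subseteq> convex hull (tet s t)"
proof (rule hull_minimal)
  have "u \<in> closed_segment s t" using assms(3) by (simp add: open_segment_def)
  then show "tet s u \<subseteq> convex hull (tet s t)"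
    unfolding tet_def[of s u]
    using curve_mem_tet[OF assms(1,2)] vertex_same_base_mem_tet[OF assms]
      vertex_swapped_base_mem_tet[OF assms]
    by (auto simp: tet_def intro: hull_inc)
qed (rule convex_convex_hull)

lemma tet_subset:
  assumes "a \<le> s" "s < t" "t \<le> b"
  shows "convex hull (tet s t) \<subseteq> convex hull (tet a b)"
proof -
  have "convex hull (tet t s) \<subseteq> convex hull (tet t a)"
    using tet_mono[of t a s] assms by (cases "s = a") (auto simp: open_segment_eq_real_ivl)
  also have "\<dots> \<subseteq> convex hull (tet a b)"
    unfolding tet_commute[of t a]
    using tet_mono[of a b t] assms by (cases "t = b") (auto simp: open_segment_eq_real_ivl)
  finally show ?thesis by (simp add: tet_commute)
qed

lemma vertex_mem_tangent:
  assumes "subtangent u s \<noteq> subtangent v s"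
  shows "vertex s t \<in> affine hull {vertex s u, vertex s v}"
proof -
  define k where "k = (subtangent t s - subtangent u s) / (subtangent v s - subtangent u s)"
  have "vertex s u + k *\<^sub>R (vertex s v - vertex s u) =
      r s - (subtangent u s + k * (subtangent v s - subtangent u s)) *\<^sub>R tangent s"
    by (simp add: vertex_def algebra_simps)
  also have "subtangent u s + k * (subtangent v s - subtangent u s) = subtangent t s"
    using assms by (simp add: k_def)
  finally have "vertex s t = vertex s u + k *\<^sub>R (vertex s v - vertex s u)" by (simp add: vertex_def)
  then show ?thesis by (auto simp: affine_hull_2_alt)
qed

lemma osculating_plane_Int_tangent:
  assumes "s \<in> {a..b}" "t \<in> {a..b}" "u \<in> {a..b}" "v \<in> {a..b}" "s \<noteq> t" "u \<noteq> t" "u \<noteq> v"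
  shows "hyperplane (osc_normal t) (r t) \<inter> affine hull {vertex s u, vertex s v} = {vertex s t}"
proof (rule hyperplane_Int_affine_hull_2)
  have "subtangent z s \<noteq> subtangent z' s" if "z \<in> {a..b}" "z' \<in> {a..b}" "z \<noteq> z'" for z z'
    using that subtangent_less[of s z z'] subtangent_less[of s z' z] assms(1)
    by (cases z z' rule: linorder_cases) auto
  then show "vertex s t \<in> affine hull {vertex s u, vertex s v}"
    "vertex s u \<notin> hyperplane (osc_normal t) (r t)"
    using assms P_pos[of t s]
    by (auto simp: mem_hyperplane inner_osc_normal_vertex osc_height_eq intro!: vertex_mem_tangent)
  show "vertex s t \<in> hyperplane (osc_normal t) (r t)"
    using assms by (simp add: mem_hyperplane inner_osc_normal_vertex osc_height_eq)
qed

lemma strictly_monotone_dist_vertex: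
  assumes "s \<in> {a..b}"
  shows "strictly_monotone_on {a<..<b} (\<lambda>t. dist (vertex s a) (vertex s t))"
proof -
  have dist_eq:
    "dist (vertex s a) (vertex s t) = (subtangent a s - subtangent t s) * norm (tangent s)"
    if "t \<in> {a<..<b}" for t
  proof -
    have "vertex s a - vertex s t = (subtangent t s - subtangent a s) *\<^sub>R tangent s"
      by (simp add: vertex_def algebra_simps)
    then show ?thesis using subtangent_less[of s a t] assms that by (simp add: dist_norm)
  qed
  have "dist (vertex s a) (vertex s t) < dist (vertex s a) (vertex s u)"
    if "t \<in> {a<..<b}" "u \<in> {a<..<b}" "t < u" for t u
    using that subtangent_less[of s t u] assms tangent_nonzero[of s] by (simp add: dist_eq)
  then show ?thesis by (simp add: strictly_monotone_on_def)
qed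

definition osc_middle_point :: "real \<Rightarrow> real ^ 3" where
  "osc_middle_point t =
     divide_point (vertex a b) (vertex b a) (osc_height a b t) (- osc_height b a t)"

definition chord_point :: "real \<Rightarrow> real ^ 3" where
  "chord_point t = divide_point (r a) (r b) (G a t / G a b) (G b t / G b a)"

definition middle_point :: "real \<Rightarrow> real ^ 3" where
  "middle_point t = divide_point (vertex a b) (vertex b a)
     (facet_height a b t / (\<Delta> a b / P a b)) (facet_height b a t / (\<Delta> b a / P b a))"

lemma endpoints_distinct:
  "r a \<noteq> r b" "vertex a b \<noteq> vertex b a" "a \<in> {a..b}" "b \<in> {a..b}" "a \<noteq> b"
  using tet_distinct[of a b] a_less_b by auto

lemma osculating_plane_Int_middle_edge:
  assumes "a < t" "t < b"
  shows "hyperplane (osc_normal t) (r t) \<inter> affine hull {vertex a b, vertex b a} =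
    {osc_middle_point t}"
  unfolding osc_middle_point_def
  by (rule hyperplane_Int_affine_hull_2_divide_point[where k = 1])
    (use assms in \<open>simp_all add: inner_osc_normal_vertex osc_height_pos osc_height_neg\<close>)

lemma plane_through_middle_edge:
  assumes "a < t" "t < b"
  shows "\<not> collinear {vertex a b, vertex b a, r t}"
    and "affine hull {vertex a b, vertex b a, r t} \<inter> affine hull {r a, r b} = {chord_point t}"
proof -
  have "{vertex a b, vertex b a, r a} \<subseteq> hyperplane (osc_normal a) (r a)"
    "{vertex a b, vertex b a, r b} \<subseteq> hyperplane (osc_normal b) (r b)"
    using osculating_facet[of a b] osculating_facet[of b a] a_less_b by auto
  note plane_through_edge_Int_opposite_edge[OF endpoints_distinct(2) this,
      of "r t" "G a t / G a b" "G b t / G b a"]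
  moreover have "G a t > 0" "G a b > 0" "G b t < 0" "G b a < 0"
    using assms a_less_b by (simp_all add: G_pos G_neg)
  ultimately show "\<not> collinear {vertex a b, vertex b a, r t}"
    "affine hull {vertex a b, vertex b a, r t} \<inter> affine hull {r a, r b} = {chord_point t}"
    by (simp_all add: chord_point_def mem_hyperplane inner_osc_normal divide_neg_neg)
qed

lemma plane_through_chord:
  assumes "a < t" "t < b"
  shows "\<not> collinear {r a, r b, r t}"
    and "affine hull {r a, r b, r t} \<inter> affine hull {vertex a b, vertex b a} = {middle_point t}"
proof -
  have "{r a, r b, vertex a b} \<subseteq> hyperplane (facet_normal a b) (r a)"
    "{r a, r b, vertex b a} \<subseteq> hyperplane (facet_normal b a) (r b)"
    using tangent_facet[of a b] tangent_facet[of b a] a_less_b by auto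
  note plane_through_edge_Int_opposite_edge[OF endpoints_distinct(1) this, of "r t"
      "facet_height a b t / (\<Delta> a b / P a b)" "facet_height b a t / (\<Delta> b a / P b a)"]
  moreover have "facet_height a b t > 0" "facet_height b a t > 0"
    "\<Delta> a b > 0" "\<Delta> b a > 0" "P a b > 0" "P b a > 0"
    using assms a_less_b
    by (auto intro!: facet_height_pos \<Delta>_pos P_pos simp: open_segment_eq_real_ivl)
  ultimately show "\<not> collinear {r a, r b, r t}"
    "affine hull {r a, r b, r t} \<inter> affine hull {vertex a b, vertex b a} = {middle_point t}"
    using a_less_b
    by (simp_all add: middle_point_def mem_hyperplane inner_facet_normal inner_facet_normal_vertex)
qed

lemma strictly_monotone_dist_osc_middle_point:
  "strictly_monotone_on {a<..<b} (\<lambda>t. dist (vertex a b) (osc_middle_point t))"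
  unfolding osc_middle_point_def
  by (rule strictly_monotone_dist_divide_point[OF endpoints_distinct(2)])
    (use osc_height_divide_less in \<open>simp_all add: osc_height_pos osc_height_neg\<close>)

lemma strictly_monotone_dist_chord_point:
  "strictly_monotone_on {a<..<b} (\<lambda>t. dist (r a) (chord_point t))"
  unfolding chord_point_def
proof (rule strictly_monotone_dist_divide_point[OF endpoints_distinct(1)])
  fix t assume "t \<in> {a<..<b}"
  then show "0 < G a t / G a b" "0 < G b t / G b a" by (simp_all add: G_pos G_neg divide_neg_neg)
next
  fix s t assume params: "s \<in> {a<..<b}" "t \<in> {a<..<b}" "s < t"
  have increasing: "G a s / G a b < G a t / G a b" and decreasing: "G b t / G b a < G b s / G b a"
    using G_less[of a s t] G_less[of b s t] G_pos[of a b] G_neg[of b a] params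
    by (simp_all add: divide_strict_right_mono divide_strict_right_mono_neg)
  have nonneg: "0 \<le> G a s / G a b" and pos: "0 < G b t / G b a"
    using params by (simp_all add: G_pos G_neg divide_neg_neg less_imp_le)
  show "G a s / G a b / (G b s / G b a) < G a t / G a b / (G b t / G b a)"
    by (rule frac_less[OF nonneg increasing pos less_imp_le[OF decreasing]])
qed

lemma strictly_monotone_dist_middle_point:
  "strictly_monotone_on {a<..<b} (\<lambda>t. dist (vertex a b) (middle_point t))"
  unfolding middle_point_def
proof (rule strictly_monotone_dist_divide_point[OF endpoints_distinct(2)])
  let ?k = "\<Delta> a b / P a b" and ?l = "\<Delta> b a / P b a"
  have weights: "?k > 0" "?l > 0" using a_less_b by (auto intro!: divide_pos_pos \<Delta>_pos P_pos)
  fix t assume interior: "t \<in> {a<..<b}"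
  then have heights: "facet_height a b t > 0" "facet_height b a t > 0"
    by (auto intro!: facet_height_pos simp: open_segment_eq_real_ivl)
  show "0 < facet_height a b t / ?k" "0 < facet_height b a t / ?l"
    by (rule divide_pos_pos[OF heights(1) weights(1)] divide_pos_pos[OF heights(2) weights(2)])+
  fix s assume "s \<in> {a<..<b}" "s < t"
  then have "?l / ?k * (facet_height a b s / facet_height b a s) <
      ?l / ?k * (facet_height a b t / facet_height b a t)"
    using interior facet_height_divide_less
    by (intro mult_strict_left_mono divide_pos_pos[OF weights(2,1)]) auto
  then show "facet_height a b s / ?k / (facet_height b a s / ?l) <
      facet_height a b t / ?k / (facet_height b a t / ?l)"
    by (simp add: ac_simps)
qed

end

section \<open>The eight properties\<close>

locale smooth_flag_curve = flag_curve a b x y w f p g x' y' w' r n1 n2 n3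
  for a b x y w f p g x' y' w' r n1 n2 n3 +
  fixes x'' x''' y'' :: "real \<Rightarrow> real"
  assumes higher_der: "\<And>t. a < t \<Longrightarrow> t < b \<Longrightarrow> (x' has_real_derivative x'' t) (at t)"
      "\<And>t. a < t \<Longrightarrow> t < b \<Longrightarrow> (x'' has_real_derivative x''' t) (at t)"
      "\<And>t. a < t \<Longrightarrow> t < b \<Longrightarrow> (y' has_real_derivative y'' t) (at t)"
begin

lemma r_expansion:
  "r t = r a + (x t - x a) *\<^sub>R e1 + (f t - f a) *\<^sub>R e2 + (g t - g a) *\<^sub>R e3"
proof -
  have "r t - r a = (x t - x a) *\<^sub>R e1 + (f t - f a) *\<^sub>R e2 + (g t - g a) *\<^sub>R e3"
    by (rule eq_if_inner_basis_eq[OF independent])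
      (simp_all only: coordinates inner_add_right inner_scaleR_right inner_dual_basis, simp_all)
  then show ?thesis by (simp add: algebra_simps)
qed

context
  fixes t :: real
  assumes interior: "a < t" "t < b"
begin

lemma has_vector_derivative_r: "(r has_vector_derivative x' t *\<^sub>R tangent t) (at t)"
  by (subst r_expansion[abs_def])
    (auto intro!: derivative_eq_intros has_deriv interior simp: tangent_def algebra_simps)

lemma has_vector_derivative_tangent: "(tangent has_vector_derivative y' t *\<^sub>R normal t) (at t)"
  unfolding tangent_def[abs_def]
  by (auto intro!: derivative_eq_intros has_deriv interior simp: normal_def algebra_simps)

lemma has_vector_derivative_normal: "(normal has_vector_derivative w' t *\<^sub>R e3) (at t)"
  unfolding normal_def[abs_def] by (auto intro!: derivative_eq_intros has_deriv interior)

lemma d1_eq: "d1 r t = x' t *\<^sub>R tangent t"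
  unfolding d1_def by (rule vector_derivative_at[OF has_vector_derivative_r])

end

lemma d2_eq: "a < t \<Longrightarrow> t < b \<Longrightarrow> d2 r t = x'' t *\<^sub>R tangent t + (x' t * y' t) *\<^sub>R normal t"
  unfolding d2_def
  by (rule vector_derivative_cong_open[where S = "{a<..<b}" and k = "\<lambda>t. x' t *\<^sub>R tangent t"])
    (auto simp: d1_eq intro!: derivative_eq_intros has_vector_derivative_tangent higher_der)

lemma d3_eq: "a < t \<Longrightarrow> t < b \<Longrightarrow> d3 r t =
    x''' t *\<^sub>R tangent t + (x'' t * y' t + (x'' t * y' t + x' t * y'' t)) *\<^sub>R normal t +
    (x' t * y' t * w' t) *\<^sub>R e3"
  unfolding d3_def
  by (rule vector_derivative_cong_open[where S = "{a<..<b}"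
        and k = "\<lambda>t. x'' t *\<^sub>R tangent t + (x' t * y' t) *\<^sub>R normal t"])
    (auto simp: d2_eq vec_eq_iff algebra_simps
      intro!: derivative_eq_intros has_vector_derivative_tangent
        has_vector_derivative_normal higher_der)

lemma cross3_d1_d2: "a < t \<Longrightarrow> t < b \<Longrightarrow>
    cross3 (d1 r t) (d2 r t) = (x' t * x' t * y' t / (cross3 n1 n2 \<bullet> n3)) *\<^sub>R osc_normal t"
  by (simp add: d1_eq d2_eq cross_add_right cross_mult_left cross_mult_right cross3_tangent_normal)

lemma curvature_torsion_nonzero:
  assumes interior: "a < t" "t < b"
  shows "d1 r t \<noteq> 0" "curvature r t \<noteq> 0" "torsion r t \<noteq> 0"
proof -
  note pos = pos[OF interior]
  show d1_nonzero: "d1 r t \<noteq> 0" using pos tangent_nonzero by (simp add: d1_eq[OF interior])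
  have cross_nonzero: "cross3 (d1 r t) (d2 r t) \<noteq> 0"
    using pos independent osc_normal_nonzero by (simp add: cross3_d1_d2[OF interior])
  then show "curvature r t \<noteq> 0" using d1_nonzero by (simp add: curvature_def)
  have "osc_normal t \<bullet> d3 r t = x' t * y' t * w' t"
    by (simp add: d3_eq[OF interior] inner_add_right inner_osc_normal)
  then have "cross3 (d1 r t) (d2 r t) \<bullet> d3 r t \<noteq> 0"
    using pos independent by (simp add: cross3_d1_d2[OF interior])
  then show "torsion r t \<noteq> 0" using cross_nonzero by (simp add: torsion_def)
qed

lemma unit_tangent_eq: "a < t \<Longrightarrow> t < b \<Longrightarrow> unit_tangent r t = sgn (tangent t)"
  using pos(1)[of t] by (simp add: unit_tangent_def d1_eq sgn_div_norm divide_inverse)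

lemma unit_binormal_eq: "a < t \<Longrightarrow> t < b \<Longrightarrow>
    unit_binormal r t = sgn (cross3 n1 n2 \<bullet> n3) *\<^sub>R sgn (osc_normal t)"
proof -
  assume interior: "a < t" "t < b"
  have "unit_binormal r t = sgn (cross3 (d1 r t) (d2 r t))"
    by (simp add: unit_binormal_def sgn_div_norm divide_inverse)
  then show ?thesis
    using pos[OF interior] by (simp add: cross3_d1_d2[OF interior] sgn_scaleR sgn_mult sgn_divide)
qed

lemma continuous_on_sgn_tangent: "continuous_on {a..b} (\<lambda>t. sgn (tangent t))"
  unfolding tangent_def
  by (intro continuous_intros continuous ballI) (use tangent_nonzero in \<open>simp add: tangent_def\<close>)

lemma continuous_on_sgn_osc_normal:
  "continuous_on {a..b} (\<lambda>t. sgn (cross3 n1 n2 \<bullet> n3) *\<^sub>R sgn (osc_normal t))"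
  unfolding osc_normal_def
  by (intro continuous_intros continuous ballI)
    (use osc_normal_nonzero in \<open>simp add: osc_normal_def\<close>)

lemma tangent_plus_eq: "a \<le> s \<Longrightarrow> s < b \<Longrightarrow> tangent_plus r s = sgn (tangent s)"
  unfolding tangent_plus_def
  by (rule Lim_at_right_continuous_on[OF continuous_on_sgn_tangent]) (auto simp: unit_tangent_eq)

lemma tangent_minus_eq: "a < s \<Longrightarrow> s \<le> b \<Longrightarrow> tangent_minus r s = sgn (tangent s)"
  unfolding tangent_minus_def
  by (rule Lim_at_left_continuous_on[OF continuous_on_sgn_tangent]) (auto simp: unit_tangent_eq)

lemma binormal_plus_eq:
  "a \<le> s \<Longrightarrow> s < b \<Longrightarrow> binormal_plus r s = sgn (cross3 n1 n2 \<bullet> n3) *\<^sub>R sgn (osc_normal s)"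
  unfolding binormal_plus_def
  by (rule Lim_at_right_continuous_on[OF continuous_on_sgn_osc_normal])
    (auto simp: unit_binormal_eq)

lemma binormal_minus_eq:
  "a < s \<Longrightarrow> s \<le> b \<Longrightarrow> binormal_minus r s = sgn (cross3 n1 n2 \<bullet> n3) *\<^sub>R sgn (osc_normal s)"
  unfolding binormal_minus_def
  by (rule Lim_at_left_continuous_on[OF continuous_on_sgn_osc_normal]) (auto simp: unit_binormal_eq)

lemma osculating_planes:
  "a < s \<Longrightarrow> s < b \<Longrightarrow> osc r s = hyperplane (osc_normal s) (r s)"
  "a \<le> s \<Longrightarrow> s < b \<Longrightarrow> osc_plus r s = hyperplane (osc_normal s) (r s)"
  "a < s \<Longrightarrow> s \<le> b \<Longrightarrow> osc_minus r s = hyperplane (osc_normal s) (r s)"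
proof -
  have "{X. (X - r s) \<bullet> sgn (cross3 n1 n2 \<bullet> n3) *\<^sub>R sgn (osc_normal s) = 0} =
      hyperplane (osc_normal s) (r s)"
    using independent osc_normal_nonzero[of s]
    by (simp add: hyperplane_def inner_commute sgn_div_norm)
  then show "a < s \<Longrightarrow> s < b \<Longrightarrow> osc r s = hyperplane (osc_normal s) (r s)"
    "a \<le> s \<Longrightarrow> s < b \<Longrightarrow> osc_plus r s = hyperplane (osc_normal s) (r s)"
    "a < s \<Longrightarrow> s \<le> b \<Longrightarrow> osc_minus r s = hyperplane (osc_normal s) (r s)"
    by (simp_all add: osc_def osc_plus_def osc_minus_def unit_binormal_eq binormal_plus_eq
      binormal_minus_eq)
qed

lemma tangent_Int_osculating_planes:
  assumes "s \<in> {a..b}" "t \<in> {a..b}" "s \<noteq> t"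
  shows "{r s + c *\<^sub>R sgn (tangent s) | c. True} \<inter>
    (hyperplane (osc_normal s) (r s) \<inter> hyperplane (osc_normal t) (r t)) = {vertex s t}"
proof -
  have "osc_normal t \<bullet> (r s + c *\<^sub>R tangent s - r t) = P t s * (c + subtangent t s)" for c
  proof -
    have "r s + c *\<^sub>R tangent s - r t = (vertex s t - r t) + (c + subtangent t s) *\<^sub>R tangent s"
      by (simp add: vertex_def algebra_simps)
    then have "osc_normal t \<bullet> (r s + c *\<^sub>R tangent s - r t) =
        osc_normal t \<bullet> (vertex s t - r t) + (c + subtangent t s) * (osc_normal t \<bullet> tangent s)"
      by (simp only: inner_add_right inner_scaleR_right)
    then show ?thesis
      using assms by (simp add: inner_osc_normal inner_osc_normal_vertex osc_height_eq)
  qed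
  then have "r s + c *\<^sub>R tangent s \<in>
      hyperplane (osc_normal s) (r s) \<inter> hyperplane (osc_normal t) (r t) \<longleftrightarrow>
      c = - subtangent t s" for c
    using P_pos[of t s] assms by (auto simp: mem_hyperplane inner_osc_normal)
  from line_sgn_Int[OF tangent_nonzero this] show ?thesis by (simp add: vertex_def)
qed

lemma assoc_tet_vertex:
  assumes "a \<le> s" "s < t" "t \<le> b"
  shows "assoc_tet r s t (r s) (vertex s t) (vertex t s) (r t)"
  using tangent_Int_osculating_planes[of s t] tangent_Int_osculating_planes[of t s]
    tet_distinct[of s t] assms
  by (simp add: assoc_tet_def tline_plus_def tline_minus_def tangent_plus_eq tangent_minus_eq
      osculating_planes Int_commute)

lemma parallel_vec_tangents:
  "parallel_vec (tangent_plus r a) (vertex a b - r a)"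
  "parallel_vec (tangent_minus r b) (r b - vertex b a)"
proof -
  have parallel: "parallel_vec (sgn (tangent s)) (k *\<^sub>R tangent s)" if "k \<noteq> 0" for s k
    using that tangent_nonzero[of s]
    by (simp add: parallel_vec_def sgn_div_norm cross_mult_left cross_mult_right)
  have "vertex a b - r a = - subtangent b a *\<^sub>R tangent a"
    "r b - vertex b a = subtangent a b *\<^sub>R tangent b"
    by (simp_all add: vertex_def)
  moreover have "subtangent b a < 0" "subtangent a b > 0"
    using subtangent_less[of a a b] subtangent_less[of b a b] a_less_b by simp_all
  ultimately show "parallel_vec (tangent_plus r a) (vertex a b - r a)"
    "parallel_vec (tangent_minus r b) (r b - vertex b a)"
    using parallel[of "- subtangent b a" a] parallel[of "subtangent a b" b] a_less_b
    by (simp_all add: tangent_plus_eq tangent_minus_eq)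
qed

lemma unique_highest_point_facet:
  assumes "{s, t} = {a, b}"
  obtains c where "a < c" "c < b"
    "\<forall>u. a < u \<and> u < b \<longrightarrow> (facet_normal s t \<bullet> tangent u = 0 \<longleftrightarrow> u = c)"
    "\<forall>u\<in>{a..b}. 0 \<le> facet_height s t u"
    "\<forall>u\<in>{a..b}. u \<noteq> c \<longrightarrow> facet_height s t u < facet_height s t c"
proof -
  have ends: "facet_height s t a = 0" "facet_height s t b = 0"
    using assms a_less_b by (auto simp: doubleton_eq_iff facet_height_endpoints)
  have positive: "facet_height s t u > 0" if "a < u" "u < b" for u
    using assms that
    by (intro facet_height_pos) (auto simp: doubleton_eq_iff open_segment_eq_real_ivl)
  have "\<exists>c. a < c \<and> c < b \<and>
      (\<forall>u. a < u \<and> u < b \<longrightarrow> (x' u * (facet_normal s t \<bullet> tangent u) = 0 \<longleftrightarrow> u = c)) \<and>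
      (\<forall>u\<in>{a..b}. u \<noteq> c \<longrightarrow> facet_height s t u < facet_height s t c)"
  proof (rule unique_critical_point_strict_max[OF a_less_b continuous_on_facet_height
        ends positive])
    show "(facet_height s t has_real_derivative x' u * (facet_normal s t \<bullet> tangent u)) (at u)"
      if "a < u" "u < b" for u
      using deriv_facet_height[OF that] by (simp add: inner_facet_normal)
    show "x' v * (facet_normal s t \<bullet> tangent v) \<noteq> 0"
      if "a < u" "u < v" "v < b" "x' u * (facet_normal s t \<bullet> tangent u) = 0" for u v
      using deriv_facet_height_unique_zero[OF assms that(1-3)] that
        pos(1)[of u] pos(1)[of v] by (simp add: inner_facet_normal)
  qed
  then obtain c where interior: "a < c" "c < b"
    and critical: "\<forall>u. a < u \<and> u < b \<longrightarrow>
      (x' u * (facet_normal s t \<bullet> tangent u) = 0 \<longleftrightarrow> u = c)"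
    and highest: "\<forall>u\<in>{a..b}. u \<noteq> c \<longrightarrow> facet_height s t u < facet_height s t c"
    by blast
  have "facet_normal s t \<bullet> tangent u = 0 \<longleftrightarrow> u = c" if "a < u" "u < b" for u
    using critical that pos(1)[OF that] by auto
  moreover have "0 \<le> facet_height s t u" if "u \<in> {a..b}" for u
    using that positive[of u] ends by (cases "u = a"; cases "u = b") auto
  ultimately show ?thesis by (intro that[OF interior _ _ highest] allI ballI impI) blast+
qed

lemma unique_parallel_point_farthest:
  assumes "{s, t} = {a, b}"
  shows "\<exists>q. parallel_points r a b (affine hull {r s, vertex s t, r t}) = {q} \<and>
    farthest_points r a b (affine hull {r s, vertex s t, r t}) = {q}"
proof -
  have params: "s \<in> {a..b}" "t \<in> {a..b}" "s \<noteq> t"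
    using assms a_less_b by (auto simp: doubleton_eq_iff)
  obtain c where interior: "a < c" "c < b"
    and critical: "\<forall>u. a < u \<and> u < b \<longrightarrow> (facet_normal s t \<bullet> tangent u = 0 \<longleftrightarrow> u = c)"
    and nonneg: "\<forall>u\<in>{a..b}. 0 \<le> facet_height s t u"
    and highest: "\<forall>u\<in>{a..b}. u \<noteq> c \<longrightarrow> facet_height s t u < facet_height s t c"
    using unique_highest_point_facet[OF assms] .
  have "parallel_to_plane (d1 r u) (hyperplane (facet_normal s t) (r s)) \<longleftrightarrow> u = c"
    if "a < u" "u < b" for u
    using critical that pos(1)[OF that]
    by (simp add: parallel_to_plane_hyperplane d1_eq[OF that])
  then have "parallel_points r a b (hyperplane (facet_normal s t) (r s)) = {r c}"
    using interior by (auto simp: parallel_points_def)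
  moreover have "farthest_points r a b (hyperplane (facet_normal s t) (r s)) = {r c}"
  proof (rule farthest_points_hyperplane)
    show "facet_normal s t \<noteq> 0" using facet_normal_pos(2)[OF params] by auto
    show "c \<in> {a..b}" using interior by simp
  qed (simp_all add: inner_facet_normal nonneg highest)
  ultimately show ?thesis unfolding affine_hull_facet(2)[OF params] by blast
qed

lemma osculating_plane_Int_edges:
  "\<exists>p01 p12 p23.
     (\<forall>t. a < t \<and> t < b \<longrightarrow>
        osc r t \<inter> affine hull {r a, vertex a b} = {p01 t} \<and>
        osc r t \<inter> affine hull {vertex a b, vertex b a} = {p12 t} \<and>
        osc r t \<inter> affine hull {vertex b a, r b} = {p23 t}) \<and>
     strictly_monotone_on {a<..<b} (\<lambda>t. dist (r a) (p01 t)) \<and>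
     strictly_monotone_on {a<..<b} (\<lambda>t. dist (vertex a b) (p12 t)) \<and>
     strictly_monotone_on {a<..<b} (\<lambda>t. dist (vertex b a) (p23 t))"
proof (intro exI conjI allI impI; (elim conjE)?)
  fix t assume interior: "a < t" "t < b"
  then show "osc r t \<inter> affine hull {r a, vertex a b} = {vertex a t}"
    "osc r t \<inter> affine hull {vertex b a, r b} = {vertex b t}"
    using osculating_plane_Int_tangent[of a t a b] osculating_plane_Int_tangent[of b t a b]
    by (simp_all add: osculating_planes vertex_self)
  show "osc r t \<inter> affine hull {vertex a b, vertex b a} = {osc_middle_point t}"
    using interior osculating_plane_Int_middle_edge by (simp add: osculating_planes)
next
  show "strictly_monotone_on {a<..<b} (\<lambda>t. dist (r a) (vertex a t))"
    "strictly_monotone_on {a<..<b} (\<lambda>t. dist (vertex b a) (vertex b t))"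
    using strictly_monotone_dist_vertex[of a] strictly_monotone_dist_vertex[of b] a_less_b
    by (simp_all add: vertex_self)
qed (rule strictly_monotone_dist_osc_middle_point)

lemma planes_through_edges_Int_opposite_edges:
  "\<exists>p03 q12.
      (\<forall>t. a < t \<and> t < b \<longrightarrow>
         \<not> collinear {vertex a b, vertex b a, r t} \<and> \<not> collinear {r a, r b, r t} \<and>
         affine hull {vertex a b, vertex b a, r t} \<inter> affine hull {r a, r b} = {p03 t} \<and>
         affine hull {r a, r b, r t} \<inter> affine hull {vertex a b, vertex b a} = {q12 t}) \<and>
      strictly_monotone_on {a<..<b} (\<lambda>t. dist (r a) (p03 t)) \<and>
      strictly_monotone_on {a<..<b} (\<lambda>t. dist (vertex a b) (q12 t))"
  by (rule exI[of _ chord_point], rule exI[of _ middle_point])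
    (simp add: plane_through_middle_edge plane_through_chord strictly_monotone_dist_chord_point
      strictly_monotone_dist_middle_point)

theorem quasi_cubic_smooth_flag_curve:
  assumes "\<forall>s\<in>I. \<forall>t. a < t \<and> t < b \<and> s \<noteq> t \<longrightarrow> r s \<noteq> r t"
  shows "quasi_cubic r I a b"
  unfolding quasi_cubic_def
proof (rule conjI[OF a_less_b], rule exI[of _ "r a"], rule exI[of _ "vertex a b"],
    rule exI[of _ "vertex b a"], rule exI[of _ "r b"], intro conjI)
  note params = endpoints_distinct(3-5)
  have tet_eq: "{r a, vertex a b, vertex b a, r b} = tet a b" by (simp add: tet_def)
  show "assoc_tet r a b (r a) (vertex a b) (vertex b a) (r b)"
    using assoc_tet_vertex a_less_b by simp
  show "\<not> coplanar {r a, vertex a b, vertex b a, r b}"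
    unfolding tet_eq using tet_not_coplanar params by simp
  show "affine hull {r a, vertex a b, vertex b a} = osc_plus r a"
    using affine_hull_facet(1)[of b a] params a_less_b
    by (simp add: osculating_planes insert_commute)
  show "affine hull {vertex a b, vertex b a, r b} = osc_minus r b"
    using affine_hull_facet(1)[of a b] params a_less_b by (simp add: osculating_planes)
  show "r ` {a..b} \<subseteq> convex hull {r a, vertex a b, vertex b a, r b}"
    unfolding tet_eq using curve_mem_tet[of a b] params by (auto simp: closed_segment_eq_real_ivl)
  show "\<forall>t. a < t \<and> t < b \<longrightarrow> \<not> singular_param r I t \<and> curvature r t \<noteq> 0 \<and> torsion r t \<noteq> 0"
    using curvature_torsion_nonzero assms unfolding singular_param_def by blast
  show "\<forall>s t. a \<le> s \<and> s < t \<and> t \<le> b \<longrightarrow> (\<exists>s0 s1 s2 s3. assoc_tet r s t s0 s1 s2 s3 \<and>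
      convex hull {s0, s1, s2, s3} \<subseteq> convex hull {r a, vertex a b, vertex b a, r b})"
    using assoc_tet_vertex tet_subset unfolding tet_def by blast
  show "\<exists>q. parallel_points r a b (affine hull {r a, vertex b a, r b}) = {q} \<and>
      farthest_points r a b (affine hull {r a, vertex b a, r b}) = {q}"
    using unique_parallel_point_farthest[of b a] by (simp add: insert_commute)
  show "\<exists>q. parallel_points r a b (affine hull {r a, vertex a b, r b}) = {q} \<and>
      farthest_points r a b (affine hull {r a, vertex a b, r b}) = {q}"
    using unique_parallel_point_farthest[of a b] by simp
qed (rule parallel_vec_tangents osculating_plane_Int_edges planes_through_edges_Int_opposite_edges)+

end

section \<open>Germs of rational curves\<close>

definition rational_germ :: "real \<Rightarrow> (real \<Rightarrow> real) \<Rightarrow> bool" where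
  "rational_germ c h \<longleftrightarrow>
     (\<exists>P Q. poly Q c \<noteq> 0 \<and> (\<forall>\<^sub>F t in nhds c. h t = poly P t / poly Q t))"

lemma tendsto_nhds_if_isCont:
  fixes h :: "real \<Rightarrow> real"
  shows "isCont h c \<Longrightarrow> (h \<longlongrightarrow> h c) (nhds c)"
  by (simp add: continuous_at tendsto_nhds_iff)

lemma eventually_poly_nonzero:
  fixes Q :: "real poly"
  shows "poly Q c \<noteq> 0 \<Longrightarrow> \<forall>\<^sub>F t in nhds c. poly Q t \<noteq> 0"
  by (rule tendsto_imp_eventually_ne[OF tendsto_nhds_if_isCont[OF poly_isCont]])

lemma rational_germ_poly: "rational_germ c (poly P)"
  unfolding rational_germ_def by (rule exI[of _ P], rule exI[of _ 1]) simp

lemma rational_germ_add: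
  assumes "rational_germ c g" "rational_germ c h"
  shows "rational_germ c (\<lambda>t. g t + h t)"
proof -
  obtain P Q where Q_nonzero: "poly Q c \<noteq> 0" and g_eq: "\<forall>\<^sub>F t in nhds c. g t = poly P t / poly Q t"
    using assms(1) unfolding rational_germ_def by auto
  obtain R S where S_nonzero: "poly S c \<noteq> 0" and h_eq: "\<forall>\<^sub>F t in nhds c. h t = poly R t / poly S t"
    using assms(2) unfolding rational_germ_def by auto
  have "\<forall>\<^sub>F t in nhds c. g t + h t = poly (P * S + R * Q) t / poly (Q * S) t"
    using g_eq h_eq eventually_poly_nonzero[OF Q_nonzero] eventually_poly_nonzero[OF S_nonzero]
    by eventually_elim (simp add: field_simps)
  then show ?thesis
    unfolding rational_germ_def using Q_nonzero S_nonzero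
    by (intro exI[of _ "P * S + R * Q"] exI[of _ "Q * S"]) simp
qed

lemma rational_germ_mult:
  assumes "rational_germ c g" "rational_germ c h"
  shows "rational_germ c (\<lambda>t. g t * h t)"
proof -
  obtain P Q where Q_nonzero: "poly Q c \<noteq> 0" and g_eq: "\<forall>\<^sub>F t in nhds c. g t = poly P t / poly Q t"
    using assms(1) unfolding rational_germ_def by auto
  obtain R S where S_nonzero: "poly S c \<noteq> 0" and h_eq: "\<forall>\<^sub>F t in nhds c. h t = poly R t / poly S t"
    using assms(2) unfolding rational_germ_def by auto
  have "\<forall>\<^sub>F t in nhds c. g t * h t = poly (P * R) t / poly (Q * S) t"
    using g_eq h_eq by eventually_elim simp
  then show ?thesis
    unfolding rational_germ_def using Q_nonzero S_nonzero
    by (intro exI[of _ "P * R"] exI[of _ "Q * S"]) simp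
qed

lemma rational_germ_inverse:
  assumes "rational_germ c h" "h c \<noteq> 0"
  shows "rational_germ c (\<lambda>t. inverse (h t))"
proof -
  obtain P Q where Q_nonzero: "poly Q c \<noteq> 0" and h_eq: "\<forall>\<^sub>F t in nhds c. h t = poly P t / poly Q t"
    using assms(1) unfolding rational_germ_def by auto
  have "\<forall>\<^sub>F t in nhds c. inverse (h t) = poly Q t / poly P t"
    using h_eq by eventually_elim simp
  moreover have "poly P c \<noteq> 0" using eventually_nhds_x_imp_x[OF h_eq] assms(2) by auto
  ultimately show ?thesis unfolding rational_germ_def by blast
qed

lemma rational_germ_deriv:
  assumes "rational_germ c h"
  obtains h' where "rational_germ c h'" "\<forall>\<^sub>F t in nhds c. (h has_real_derivative h' t) (at t)"
proof -
  obtain P Q where Q_nonzero: "poly Q c \<noteq> 0" and h_eq: "\<forall>\<^sub>F t in nhds c. h t = poly P t / poly Q t"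
    using assms unfolding rational_germ_def by auto
  define h' where "h' t = poly (pderiv P * Q - P * pderiv Q) t / poly (Q * Q) t" for t
  have "rational_germ c h'"
    unfolding rational_germ_def h'_def using Q_nonzero
    by (intro exI[of _ "pderiv P * Q - P * pderiv Q"] exI[of _ "Q * Q"]) simp
  moreover have "\<forall>\<^sub>F t in nhds c. (h has_real_derivative h' t) (at t)"
    using eventually_poly_nonzero[OF Q_nonzero] h_eq[THEN eventually_eventually[THEN iffD2]]
  proof eventually_elim
    case (elim t)
    have "((\<lambda>t. poly P t / poly Q t) has_real_derivative h' t) (at t)"
      using elim(1) by (auto intro!: derivative_eq_intros simp: h'_def)
    then show ?case using DERIV_cong_ev[OF refl elim(2) refl] by blast
  qed
  ultimately show ?thesis using that by blast
qed

lemma rational_germ_tendsto: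
  assumes "rational_germ c h"
  shows "(h \<longlongrightarrow> h c) (nhds c)"
proof -
  obtain h' where "\<forall>\<^sub>F t in nhds c. (h has_real_derivative h' t) (at t)"
    using rational_germ_deriv[OF assms] .
  then show ?thesis
    by (intro tendsto_nhds_if_isCont DERIV_isCont) (rule eventually_nhds_x_imp_x)
qed

definition positive_germ :: "real \<Rightarrow> nat \<Rightarrow> (real \<Rightarrow> real) \<Rightarrow> bool" where
  "positive_germ c k h \<longleftrightarrow>
     (\<exists>u. rational_germ c u \<and> u c > 0 \<and> (\<forall>\<^sub>F t in nhds c. h t = (t - c) ^ k * u t))"

lemma rational_germ_if_positive_germ:
  assumes "positive_germ c k h"
  shows "rational_germ c h"
proof -
  obtain u where u_germ: "rational_germ c u" and h_eq: "\<forall>\<^sub>F t in nhds c. h t = (t - c) ^ k * u t"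
    using assms unfolding positive_germ_def by auto
  have "rational_germ c (\<lambda>t. poly ([:- c, 1:] ^ k) t * u t)"
    by (rule rational_germ_mult[OF rational_germ_poly u_germ])
  then obtain P Q where "poly Q c \<noteq> 0"
    and "\<forall>\<^sub>F t in nhds c. poly ([:- c, 1:] ^ k) t * u t = poly P t / poly Q t"
    unfolding rational_germ_def by auto
  moreover from this(2) h_eq have "\<forall>\<^sub>F t in nhds c. h t = poly P t / poly Q t"
    by eventually_elim simp
  ultimately show ?thesis unfolding rational_germ_def by blast
qed

lemma eventually_pos_if_positive_germ:
  assumes "positive_germ c k h"
  shows "\<forall>\<^sub>F t in nhds c. c < t \<longrightarrow> h t > 0"
proof -
  obtain u where u_germ: "rational_germ c u" "u c > 0"
    and h_eq: "\<forall>\<^sub>F t in nhds c. h t = (t - c) ^ k * u t"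
    using assms unfolding positive_germ_def by auto
  have "\<forall>\<^sub>F t in nhds c. 0 < u t"
    by (rule order_tendstoD(1)[OF rational_germ_tendsto[OF u_germ(1)] u_germ(2)])
  with h_eq show ?thesis by eventually_elim simp
qed

lemma positive_germ_deriv:
  assumes "positive_germ c (Suc k) h"
  obtains h' where "positive_germ c k h'" "\<forall>\<^sub>F t in nhds c. (h has_real_derivative h' t) (at t)"
proof -
  obtain u where u_germ: "rational_germ c u" "u c > 0"
    and h_eq: "\<forall>\<^sub>F t in nhds c. h t = (t - c) ^ Suc k * u t"
    using assms unfolding positive_germ_def by auto
  obtain u' where u'_germ: "rational_germ c u'"
    "\<forall>\<^sub>F t in nhds c. (u has_real_derivative u' t) (at t)"
    using rational_germ_deriv[OF u_germ(1)] .
  define v where "v t = poly [:real (Suc k):] t * u t + poly [:- c, 1:] t * u' t" for t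
  have "rational_germ c v"
    unfolding v_def
    by (intro rational_germ_add rational_germ_mult rational_germ_poly u_germ(1) u'_germ(1))
  moreover have "v c > 0" using u_germ(2) by (simp add: v_def)
  ultimately have "positive_germ c k (\<lambda>t. (t - c) ^ k * v t)"
    unfolding positive_germ_def by (intro exI[of _ v]) simp
  moreover have "\<forall>\<^sub>F t in nhds c. (h has_real_derivative (t - c) ^ k * v t) (at t)"
    using u'_germ(2) h_eq[THEN eventually_eventually[THEN iffD2]]
  proof eventually_elim
    case (elim t)
    have "((\<lambda>t. (t - c) ^ n) has_real_derivative real n * (t - c) ^ (n - 1)) (at t)" for n
      by (auto intro!: derivative_eq_intros)
    from DERIV_mult[OF this[of "Suc k"] elim(1)]
    have "((\<lambda>t. (t - c) ^ Suc k * u t) has_real_derivative (t - c) ^ k * v t) (at t)"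
      by (rule DERIV_cong) (simp add: v_def algebra_simps)
    then show ?case using DERIV_cong_ev[OF refl elim(2) refl] by blast
  qed
  ultimately show ?thesis using that by blast
qed

lemma positive_germ_divide:
  assumes "positive_germ c (k + j) h" "positive_germ c j d"
  obtains q where "positive_germ c k q" "\<forall>\<^sub>F t in nhds c. h t = q t * d t"
proof -
  obtain u where u_germ: "rational_germ c u" "u c > 0"
    and h_eq: "\<forall>\<^sub>F t in nhds c. h t = (t - c) ^ (k + j) * u t"
    using assms(1) unfolding positive_germ_def by auto
  obtain v where v_germ: "rational_germ c v" "v c > 0"
    and d_eq: "\<forall>\<^sub>F t in nhds c. d t = (t - c) ^ j * v t"
    using assms(2) unfolding positive_germ_def by auto
  have "rational_germ c (\<lambda>t. u t * inverse (v t))"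
    using v_germ by (intro rational_germ_mult rational_germ_inverse u_germ(1)) auto
  then have "positive_germ c k (\<lambda>t. (t - c) ^ k * (u t * inverse (v t)))"
    unfolding positive_germ_def using u_germ(2) v_germ(2)
    by (intro exI[of _ "\<lambda>t. u t * inverse (v t)"]) simp
  moreover have "\<forall>\<^sub>F t in nhds c. v t \<noteq> 0"
    by (rule tendsto_imp_eventually_ne[OF rational_germ_tendsto[OF v_germ(1)]])
      (use v_germ(2) in simp)
  with h_eq d_eq have "\<forall>\<^sub>F t in nhds c. h t = (t - c) ^ k * (u t * inverse (v t)) * d t"
    by eventually_elim (simp add: power_add)
  ultimately show ?thesis using that by blast
qed

lemma positive_germ_deriv_divide:
  assumes "positive_germ c (Suc (k + j)) h" "positive_germ c j d"
  obtains q where "positive_germ c k q" "\<forall>\<^sub>F t in nhds c. (h has_real_derivative q t * d t) (at t)"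
proof -
  obtain h' where h'_germ: "positive_germ c (k + j) h'"
    "\<forall>\<^sub>F t in nhds c. (h has_real_derivative h' t) (at t)"
    using positive_germ_deriv[OF assms(1)] .
  obtain q where q_germ: "positive_germ c k q" "\<forall>\<^sub>F t in nhds c. h' t = q t * d t"
    using positive_germ_divide[OF h'_germ(1) assms(2)] .
  from h'_germ(2) q_germ(2) have "\<forall>\<^sub>F t in nhds c. (h has_real_derivative q t * d t) (at t)"
    by eventually_elim simp
  with q_germ(1) show ?thesis by (rule that)
qed

lemma eventually_at_right_ball_Icc:
  fixes c :: real
  assumes "\<forall>\<^sub>F t in nhds c. R t"
  shows "\<forall>\<^sub>F b in at_right c. \<forall>t\<in>{c..b}. R t"
proof -
  obtain e where radius: "e > 0" "\<And>t. dist t c < e \<Longrightarrow> R t"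
    using assms unfolding eventually_nhds_metric by blast
  have "\<forall>\<^sub>F b in at_right c. b < c + e"
    by (rule order_tendstoD(2)[OF tendsto_ident_at]) (use radius(1) in simp)
  then show ?thesis by eventually_elim (auto intro!: radius(2) simp: dist_real_def)
qed

lemma eventually_positive_path:
  assumes derivs: "\<forall>\<^sub>F t in nhds c. (x has_real_derivative x' t) (at t)"
      "\<forall>\<^sub>F t in nhds c. (y has_real_derivative y' t) (at t)"
      "\<forall>\<^sub>F t in nhds c. (w has_real_derivative w' t) (at t)"
      "\<forall>\<^sub>F t in nhds c. (f has_real_derivative y t * x' t) (at t)"
      "\<forall>\<^sub>F t in nhds c. (p has_real_derivative w t * y' t) (at t)"
      "\<forall>\<^sub>F t in nhds c. (g has_real_derivative p t * x' t) (at t)"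
    and pos: "\<forall>\<^sub>F t in nhds c. c < t \<longrightarrow> x' t > 0" "\<forall>\<^sub>F t in nhds c. c < t \<longrightarrow> y' t > 0"
      "\<forall>\<^sub>F t in nhds c. c < t \<longrightarrow> w' t > 0"
  shows "\<forall>\<^sub>F b in at_right c. positive_path c b x y w f p g x' y' w'"
  using eventually_at_right_less derivs[THEN eventually_at_right_ball_Icc]
    pos[THEN eventually_at_right_ball_Icc]
proof eventually_elim
  case (elim b)
  have "continuous_on {c..b} h"
    if "\<forall>t\<in>{c..b}. (h has_real_derivative h' t) (at t)" for h h' :: "real \<Rightarrow> real"
    by (rule DERIV_continuous_on) (use that in \<open>blast intro: has_field_derivative_at_within\<close>)
  note continuous = this[OF elim(2)] this[OF elim(3)] this[OF elim(4)] this[OF elim(5)]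
    this[OF elim(6)] this[OF elim(7)]
  show ?case by (rule positive_path.intro) (simp_all add: elim continuous)
qed

lemma positive_path_of_positive_germs:
  assumes x_germ: "positive_germ c k1 x" and f_germ: "positive_germ c k2 f"
    and g_germ: "positive_germ c k3 g"
    and orders: "0 < k1" "k1 < k2" "k2 < k3"
  obtains y w p x' y' w' where "rational_germ c x'" "rational_germ c y'"
    "\<forall>\<^sub>F b in at_right c. positive_path c b x y w f p g x' y' w'"
proof -
  define i j l where "i = k1 - 1" and "j = k2 - k1 - 1" and "l = k3 - k2 - 1"
  then have gaps: "k1 = Suc i" "k2 = Suc (Suc j + i)" "k3 = Suc (Suc (Suc l + j) + i)"
    using orders by auto
  obtain x' where x'_germ: "positive_germ c i x'"
    "\<forall>\<^sub>F t in nhds c. (x has_real_derivative x' t) (at t)"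
    using positive_germ_deriv[OF x_germ[unfolded gaps]] .
  obtain y where y_germ: "positive_germ c (Suc j) y"
    "\<forall>\<^sub>F t in nhds c. (f has_real_derivative y t * x' t) (at t)"
    using positive_germ_deriv_divide[OF f_germ[unfolded gaps] x'_germ(1)] .
  obtain p where p_germ: "positive_germ c (Suc (Suc l + j)) p"
    "\<forall>\<^sub>F t in nhds c. (g has_real_derivative p t * x' t) (at t)"
    using positive_germ_deriv_divide[OF g_germ[unfolded gaps] x'_germ(1)] .
  obtain y' where y'_germ: "positive_germ c j y'"
    "\<forall>\<^sub>F t in nhds c. (y has_real_derivative y' t) (at t)"
    using positive_germ_deriv[OF y_germ(1)] .
  obtain w where w_germ: "positive_germ c (Suc l) w"
    "\<forall>\<^sub>F t in nhds c. (p has_real_derivative w t * y' t) (at t)"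
    using positive_germ_deriv_divide[OF p_germ(1) y'_germ(1)] .
  obtain w' where w'_germ: "positive_germ c l w'"
    "\<forall>\<^sub>F t in nhds c. (w has_real_derivative w' t) (at t)"
    using positive_germ_deriv[OF w_germ(1)] .
  have "\<forall>\<^sub>F b in at_right c. positive_path c b x y w f p g x' y' w'"
    by (intro eventually_positive_path x'_germ(2) y'_germ(2) w'_germ(2) y_germ(2) w_germ(2)
        p_germ(2) eventually_pos_if_positive_germ[OF x'_germ(1)]
        eventually_pos_if_positive_germ[OF y'_germ(1)]
        eventually_pos_if_positive_germ[OF w'_germ(1)])
  then show ?thesis using x'_germ(1) y'_germ(1) by (intro that rational_germ_if_positive_germ)
qed

section \<open>A flag adapted to the orders of vanishing\<close>

definition poly_comb :: "real poly ^ 'n \<Rightarrow> real ^ 'n \<Rightarrow> real poly" where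
  "poly_comb h n = (\<Sum>i\<in>UNIV. smult (n $ i) (h $ i))"

lemma poly_comb_diff_scaleR: "poly_comb h (n - k *\<^sub>R m) = poly_comb h n - smult k (poly_comb h m)"
  by (rule poly_eqI)
    (simp add: poly_comb_def coeff_sum sum_subtractf[symmetric] sum_distrib_left left_diff_distrib
      mult.assoc)

lemma order_poly_comb_le:
  assumes "poly_comb h n \<noteq> 0"
  shows "order c (poly_comb h n) \<le> (\<Sum>i\<in>UNIV. degree (h $ i))"
proof -
  have "order c (poly_comb h n) \<le> degree (poly_comb h n)" by (rule order_degree[OF assms])
  also have "\<dots> \<le> (\<Sum>i\<in>UNIV. degree (h $ i))"
    unfolding poly_comb_def
    by (intro degree_sum_le order_trans[OF degree_smult_le] member_le_sum) auto
  finally show ?thesis .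
qed

lemma order_diff_smult_gt:
  fixes p q :: "real poly"
  assumes "p \<noteq> 0" "q \<noteq> 0" "order c p = order c q"
  obtains k where "p - smult k q = 0 \<or> order c (p - smult k q) > order c p"
proof -
  obtain u where p_eq: "p = [:- c, 1:] ^ order c p * u" using order_decomp[OF assms(1)] by blast
  obtain v where q_eq: "q = [:- c, 1:] ^ order c p * v" "\<not> [:- c, 1:] dvd v"
    using order_decomp[OF assms(2), of c] assms(3) by auto
  define k where "k = poly u c / poly v c"
  have "poly v c \<noteq> 0" using q_eq(2) by (simp add: poly_eq_0_iff_dvd)
  then have "poly (u - smult k v) c = 0" by (simp add: k_def)
  then have "[:- c, 1:] dvd u - smult k v" unfolding poly_eq_0_iff_dvd .
  then have "[:- c, 1:] ^ order c p * [:- c, 1:] dvd [:- c, 1:] ^ order c p * (u - smult k v)"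
    by (rule mult_dvd_mono[OF dvd_refl])
  also have "[:- c, 1:] ^ order c p * (u - smult k v) = p - smult k q"
    by (subst (2) p_eq, subst q_eq) (simp add: algebra_simps)
  finally have "[:- c, 1:] ^ Suc (order c p) dvd p - smult k q" by (simp add: mult.commute)
  then show ?thesis using that[of k] unfolding order_divides by auto
qed

abbreviation comb_order :: "real poly ^ 'n \<Rightarrow> real \<Rightarrow> real ^ 'n \<Rightarrow> nat" where
  "comb_order h c n \<equiv> order c (poly_comb h n)"

context
  fixes h :: "real poly ^ 'n" and c :: real
  assumes nonzero: "\<And>n. n \<noteq> 0 \<Longrightarrow> poly_comb h n \<noteq> 0"
begin

lemma ex_is_arg_max_comb_order:
  assumes "S n" "\<not> S 0"
  obtains m where "is_arg_max (comb_order h c) S m"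
proof -
  have "comb_order h c m < Suc (\<Sum>i\<in>UNIV. degree (h $ i))" if "S m" for m
  proof -
    have "m \<noteq> 0" using that assms(2) by auto
    from order_poly_comb_le[OF nonzero[OF this]] show ?thesis by (rule le_imp_less_Suc)
  qed
  then have "S (arg_max (comb_order h c) S) \<and>
      (\<forall>m. S m \<longrightarrow> comb_order h c m \<le> comb_order h c (arg_max (comb_order h c) S))"
    by (intro arg_max_nat_lemma[where P = S and f = "comb_order h c", OF assms(1)] allI impI)
  then show ?thesis using that[of "arg_max (comb_order h c) S"] by (simp add: is_arg_max_linorder)
qed

lemma comb_order_neq_if_is_arg_max:
  assumes "is_arg_max (comb_order h c) S m" "\<not> S 0" "n \<noteq> 0"
    and shift: "\<And>k. S (m - k *\<^sub>R n)"
  shows "comb_order h c m \<noteq> comb_order h c n"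
proof
  assume orders_eq: "comb_order h c m = comb_order h c n"
  have "S m" and maximal: "\<And>n. S n \<Longrightarrow> comb_order h c n \<le> comb_order h c m"
    using assms(1) by (auto simp: is_arg_max_linorder)
  then have "m \<noteq> 0" using assms(2) by auto
  obtain k where "poly_comb h (m - k *\<^sub>R n) = 0 \<or> comb_order h c (m - k *\<^sub>R n) > comb_order h c m"
    using order_diff_smult_gt[OF nonzero[OF \<open>m \<noteq> 0\<close>] nonzero[OF \<open>n \<noteq> 0\<close>] orders_eq]
    unfolding poly_comb_diff_scaleR .
  moreover have "m - k *\<^sub>R n \<noteq> 0" using assms(2) shift[of k] by auto
  ultimately show False using maximal[OF shift[of k]] nonzero by auto
qed

end

text \<open>The covectors \<open>m3\<close>, \<open>m2\<close>, \<open>m1\<close> are chosen in turn, each of maximal order outside the span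
  of the previous ones: if two orders agreed, cancelling leading terms would raise one of them.\<close>

lemma adapted_basis:
  fixes h :: "real poly ^ 3"
  assumes nonzero: "\<And>n. n \<noteq> 0 \<Longrightarrow> poly_comb h n \<noteq> 0"
  obtains m1 m2 m3 where "cross3 m1 m2 \<bullet> m3 \<noteq> 0"
    "comb_order h c m1 < comb_order h c m2" "comb_order h c m2 < comb_order h c m3"
proof -
  obtain m3 where m3_max: "is_arg_max (comb_order h c) (\<lambda>n. n \<noteq> 0) m3"
    by (rule ex_is_arg_max_comb_order[OF nonzero, of "\<lambda>n. n \<noteq> 0" "axis 1 1"])
      (auto simp: axis_eq_0_iff)
  then have "m3 \<noteq> 0" by (simp add: is_arg_max_linorder)
  then obtain n where "cross3 n m3 \<noteq> 0"
    using cross_basis_nonzero cross_skew by (metis neg_equal_0_iff_equal)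
  then obtain m2 where m2_max: "is_arg_max (comb_order h c) (\<lambda>n. cross3 n m3 \<noteq> 0) m2"
    using ex_is_arg_max_comb_order[OF nonzero, of "\<lambda>n. cross3 n m3 \<noteq> 0" n] cross_zero_left by blast
  then have "cross3 m2 m3 \<noteq> 0" by (simp add: is_arg_max_linorder)
  then have "cross3 (cross3 m2 m3) m2 \<bullet> m3 \<noteq> 0"
    using cross_triple[of "cross3 m2 m3" m2 m3] by simp
  then obtain m1 where m1_max: "is_arg_max (comb_order h c) (\<lambda>n. cross3 n m2 \<bullet> m3 \<noteq> 0) m1"
    using ex_is_arg_max_comb_order[OF nonzero, of "\<lambda>n. cross3 n m2 \<bullet> m3 \<noteq> 0" "cross3 m2 m3"]
    by auto
  then have independent: "cross3 m1 m2 \<bullet> m3 \<noteq> 0" by (simp add: is_arg_max_linorder)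
  then have "cross3 m3 m1 \<noteq> 0" using cross_triple[of m3 m1 m2] by auto
  then have "cross3 m1 m3 \<noteq> 0" using cross_skew[of m1 m3] by simp
  moreover have "m2 \<noteq> 0" using \<open>cross3 m2 m3 \<noteq> 0\<close> by auto
  ultimately have "comb_order h c m1 \<le> comb_order h c m2" "comb_order h c m2 \<le> comb_order h c m3"
    using m2_max m3_max by (simp_all add: is_arg_max_linorder)
  moreover have "comb_order h c m1 \<noteq> comb_order h c m2"
    by (rule comb_order_neq_if_is_arg_max[OF nonzero m1_max])
      (use \<open>m2 \<noteq> 0\<close> independent in \<open>simp_all add: Cross3.left_diff_distrib cross_mult_left\<close>)
  moreover have "comb_order h c m2 \<noteq> comb_order h c m3"
    by (rule comb_order_neq_if_is_arg_max[OF nonzero m2_max])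
      (use \<open>cross3 m2 m3 \<noteq> 0\<close> \<open>m3 \<noteq> 0\<close> in \<open>simp_all add: Cross3.left_diff_distrib cross_mult_left\<close>)
  ultimately show ?thesis using that independent by (simp add: less_le)
qed

definition numerators :: "real poly ^ 3 \<Rightarrow> real poly ^ 3 \<Rightarrow> real \<Rightarrow> real poly ^ 3" where
  "numerators p q c =
     (\<chi> i. (p $ i - smult (rat_curve p q c $ i) (q $ i)) * (\<Prod>j\<in>UNIV - {i}. q $ j))"

lemma poly_comb_numerators:
  assumes "\<forall>i. poly (q $ i) t \<noteq> 0"
  shows "poly (poly_comb (numerators p q c) n) t / poly (\<Prod>j\<in>UNIV. q $ j) t =
    n \<bullet> (rat_curve p q t - rat_curve p q c)"
proof -
  have "poly (smult (n $ i) (numerators p q c $ i)) t / poly (\<Prod>j\<in>UNIV. q $ j) t =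
      n $ i * (rat_curve p q t - rat_curve p q c) $ i" for i
  proof -
    have "(\<Prod>j\<in>UNIV. q $ j) = q $ i * (\<Prod>j\<in>UNIV - {i}. q $ j)" by (rule prod.remove) auto
    moreover have "poly (\<Prod>j\<in>UNIV - {i}. q $ j) t \<noteq> 0" using assms by (simp add: poly_prod)
    ultimately show ?thesis using assms by (simp add: numerators_def rat_curve_def field_simps)
  qed
  then show ?thesis unfolding poly_comb_def poly_sum sum_divide_distrib inner_vec_def by simp
qed

lemma poly_comb_numerators_nonzero:
  assumes "\<forall>i. \<forall>t\<in>I. poly (q $ i) t \<noteq> 0" "non_planar (rat_curve p q) I" "n \<noteq> 0"
  shows "poly_comb (numerators p q c) n \<noteq> 0"
proof
  assume "poly_comb (numerators p q c) n = 0"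
  then have "n \<bullet> rat_curve p q t = n \<bullet> rat_curve p q c" if "t \<in> I" for t
    using poly_comb_numerators[of q t p c n] assms(1) that by (simp add: inner_diff_right)
  then show False using assms(2,3) unfolding non_planar_def by blast
qed

lemma positive_germ_coordinate:
  assumes denominators: "\<forall>i. poly (q $ i) c \<noteq> 0" and nonzero: "poly_comb (numerators p q c) n \<noteq> 0"
  obtains k where "k \<noteq> 0" "positive_germ c (comb_order (numerators p q c) c n)
    (\<lambda>t. (k *\<^sub>R n) \<bullet> (rat_curve p q t - rat_curve p q c))"
proof -
  define h where "h = poly_comb (numerators p q c) n"
  define d where "d = (\<Prod>j\<in>UNIV. q $ j)"
  have d_nonzero: "poly d t \<noteq> 0 \<longleftrightarrow> (\<forall>i. poly (q $ i) t \<noteq> 0)" for t by (simp add: d_def poly_prod)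
  obtain u where h_eq: "h = [:- c, 1:] ^ order c h * u" "\<not> [:- c, 1:] dvd u"
    using order_decomp nonzero unfolding h_def by blast
  define k where "k = poly u c / poly d c"
  have "k \<noteq> 0" using h_eq(2) denominators d_nonzero by (simp add: k_def poly_eq_0_iff_dvd)
  define v where "v t = poly (smult k u) t * inverse (poly d t)" for t
  have "rational_germ c v"
    unfolding v_def using denominators d_nonzero
    by (intro rational_germ_mult rational_germ_inverse rational_germ_poly) auto
  moreover have "v c = k * k" by (simp add: v_def k_def divide_inverse)
  then have "v c > 0" using \<open>k \<noteq> 0\<close> by (metis not_real_square_gt_zero)
  moreover have "\<forall>\<^sub>F t in nhds c.
      (k *\<^sub>R n) \<bullet> (rat_curve p q t - rat_curve p q c) = (t - c) ^ order c h * v t"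
    using eventually_poly_nonzero[OF d_nonzero[THEN iffD2, OF denominators]]
  proof eventually_elim
    case (elim t)
    have "poly h t = (t - c) ^ order c h * poly u t" by (subst h_eq(1)) simp
    then show ?case
      using poly_comb_numerators[of q t p c n] elim d_nonzero[of t]
      by (simp add: v_def h_def d_def divide_inverse)
  qed
  ultimately have "positive_germ c (order c h) (\<lambda>t. (k *\<^sub>R n) \<bullet> (rat_curve p q t - rat_curve p q c))"
    unfolding positive_germ_def by blast
  then show ?thesis using that \<open>k \<noteq> 0\<close> unfolding h_def by blast
qed

lemma adapted_coordinates:
  assumes "\<forall>i. \<forall>t\<in>I. poly (q $ i) t \<noteq> 0" "non_planar (rat_curve p q) I" "c \<in> I"
  obtains n1 n2 n3 k1 k2 k3 where "cross3 n1 n2 \<bullet> n3 \<noteq> 0" "0 < k1" "k1 < k2" "k2 < k3"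
    "positive_germ c k1 (\<lambda>t. n1 \<bullet> (rat_curve p q t - rat_curve p q c))"
    "positive_germ c k2 (\<lambda>t. n2 \<bullet> (rat_curve p q t - rat_curve p q c))"
    "positive_germ c k3 (\<lambda>t. n3 \<bullet> (rat_curve p q t - rat_curve p q c))"
proof -
  let ?ord = "comb_order (numerators p q c) c"
  have denominators: "\<forall>i. poly (q $ i) c \<noteq> 0" using assms(1,3) by blast
  note nonzero = poly_comb_numerators_nonzero[OF assms(1,2)]
  obtain m1 m2 m3 where basis: "cross3 m1 m2 \<bullet> m3 \<noteq> 0" "?ord m1 < ?ord m2" "?ord m2 < ?ord m3"
    using adapted_basis[OF nonzero] .
  then have m_nonzero: "m1 \<noteq> 0" "m2 \<noteq> 0" "m3 \<noteq> 0" by auto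
  have "poly (poly_comb (numerators p q c) m1) c = 0"
    using poly_comb_numerators[OF denominators, of p c m1] denominators by (simp add: poly_prod)
  then have "0 < ?ord m1" using nonzero[OF m_nonzero(1)] by (simp add: order_root)
  obtain l1 where coord1: "l1 \<noteq> 0"
    "positive_germ c (?ord m1) (\<lambda>t. (l1 *\<^sub>R m1) \<bullet> (rat_curve p q t - rat_curve p q c))"
    using positive_germ_coordinate[OF denominators nonzero[OF m_nonzero(1)]] .
  obtain l2 where coord2: "l2 \<noteq> 0"
    "positive_germ c (?ord m2) (\<lambda>t. (l2 *\<^sub>R m2) \<bullet> (rat_curve p q t - rat_curve p q c))"
    using positive_germ_coordinate[OF denominators nonzero[OF m_nonzero(2)]] .
  obtain l3 where coord3: "l3 \<noteq> 0"
    "positive_germ c (?ord m3) (\<lambda>t. (l3 *\<^sub>R m3) \<bullet> (rat_curve p q t - rat_curve p q c))"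
    using positive_germ_coordinate[OF denominators nonzero[OF m_nonzero(3)]] .
  have "cross3 (l1 *\<^sub>R m1) (l2 *\<^sub>R m2) \<bullet> (l3 *\<^sub>R m3) \<noteq> 0"
    using basis(1) coord1(1) coord2(1) coord3(1) by (simp add: cross_mult_left cross_mult_right)
  then show ?thesis using \<open>0 < ?ord m1\<close> basis(2,3) coord1(2) coord2(2) coord3(2) by (rule that)
qed

lemma eventually_quasi_cubic:
  assumes "\<forall>i. \<forall>t\<in>I. poly (q $ i) t \<noteq> 0" "non_planar (rat_curve p q) I" "c \<in> I"
  shows "\<forall>\<^sub>F b in at_right c. \<forall>J.
    (\<forall>s\<in>J. \<forall>t. c < t \<and> t < b \<and> s \<noteq> t \<longrightarrow> rat_curve p q s \<noteq> rat_curve p q t) \<longrightarrow>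
    quasi_cubic (rat_curve p q) J c b"
proof -
  let ?r = "rat_curve p q" and ?coord = "\<lambda>n t. n \<bullet> (rat_curve p q t - rat_curve p q c)"
  obtain n1 n2 n3 k1 k2 k3 where independent: "cross3 n1 n2 \<bullet> n3 \<noteq> 0"
    and orders: "0 < k1" "k1 < k2" "k2 < k3"
    and germs: "positive_germ c k1 (?coord n1)" "positive_germ c k2 (?coord n2)"
      "positive_germ c k3 (?coord n3)"
    using adapted_coordinates[OF assms] .
  obtain y w z x' y' w' where rational: "rational_germ c x'" "rational_germ c y'"
    and path: "\<forall>\<^sub>F b in at_right c.
      positive_path c b (?coord n1) y w (?coord n2) z (?coord n3) x' y' w'"
    using positive_path_of_positive_germs[OF germs orders] .
  obtain x'' where x'': "rational_germ c x''"
    "\<forall>\<^sub>F t in nhds c. (x' has_real_derivative x'' t) (at t)"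
    using rational_germ_deriv[OF rational(1)] .
  obtain x''' where x''': "\<forall>\<^sub>F t in nhds c. (x'' has_real_derivative x''' t) (at t)"
    using rational_germ_deriv[OF x''(1)] .
  obtain y'' where y'': "\<forall>\<^sub>F t in nhds c. (y' has_real_derivative y'' t) (at t)"
    using rational_germ_deriv[OF rational(2)] .
  from path x''(2)[THEN eventually_at_right_ball_Icc] x'''[THEN eventually_at_right_ball_Icc]
    y''[THEN eventually_at_right_ball_Icc]
  show ?thesis
  proof eventually_elim
    case (elim b)
    have "smooth_flag_curve c b (?coord n1) y w (?coord n2) z (?coord n3) x' y' w'
        ?r n1 n2 n3 x'' x''' y''"
      by (intro smooth_flag_curve.intro flag_curve.intro flag_curve_axioms.intro
          smooth_flag_curve_axioms.intro elim(1) independent)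
        (simp_all add: elim inner_diff_right)
    then show ?case by (blast intro: smooth_flag_curve.quasi_cubic_smooth_flag_curve)
  qed
qed

section \<open>Properness and the theorem\<close>

lemma poly_map_poly_complex_of_real:
  "poly (map_poly complex_of_real p) (complex_of_real t) = complex_of_real (poly p t)"
  by (induction p) (auto simp: map_poly_pCons)

lemma rat_curve_c_of_real:
  "rat_curve_c p q (complex_of_real t) i = complex_of_real (rat_curve p q t $ i)"
  by (simp add: rat_curve_c_def rat_curve_def poly_map_poly_complex_of_real)

lemma eventually_at_right_disjoint_finite:
  fixes c :: real
  assumes "finite S"
  shows "\<forall>\<^sub>F b in at_right c. S \<inter> {c<..<b} = {}"
proof -
  obtain d where gap: "d > 0" "\<And>t. t \<in> S \<Longrightarrow> t \<noteq> c \<Longrightarrow> d \<le> dist c t"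
    using finite_set_avoid[OF assms, of c] by blast
  have "S \<inter> {c<..<b} = {}" if "b < c + d" for b
    using gap(2) that by (force simp: dist_real_def)
  then show ?thesis using gap(1) by (auto simp: eventually_at_right_field intro!: exI[of _ "c + d"])
qed

lemma eventually_no_double_point:
  assumes "proper_param p q" "\<forall>i. \<forall>t\<in>I. poly (q $ i) t \<noteq> 0"
  shows "\<forall>\<^sub>F b in at_right c.
    \<forall>s\<in>I. \<forall>t\<in>I. c < t \<and> t < b \<and> s \<noteq> t \<longrightarrow> rat_curve p q s \<noteq> rat_curve p q t"
proof -
  define D where "D = {z. defined_at_c q z \<and>
    (\<exists>w. w \<noteq> z \<and> defined_at_c q w \<and> rat_curve_c p q w = rat_curve_c p q z)}"
  have "finite (complex_of_real -` D)"
    using assms(1) unfolding proper_param_def D_def by (rule finite_vimageI) (simp add: inj_def)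
  from eventually_at_right_disjoint_finite[OF this, of c] show ?thesis
  proof eventually_elim
    case (elim b)
    have defined: "defined_at_c q (complex_of_real t)" if "t \<in> I" for t
      using that assms(2) by (simp add: defined_at_c_def poly_map_poly_complex_of_real)
    have "complex_of_real t \<in> D"
      if "s \<in> I" "t \<in> I" "s \<noteq> t" "rat_curve p q s = rat_curve p q t" for s t
      using that defined unfolding D_def
      by (auto simp: rat_curve_c_of_real fun_eq_iff intro!: exI[of _ "complex_of_real s"])
    with elim show ?case by (fastforce simp: disjoint_iff)
  qed
qed

theorem theorem1:
  fixes p q :: "real poly ^ 3" and I :: "real set" and t0 :: real
  assumes "is_interval I"
    and "\<forall>i. \<forall>t\<in>I. poly (q $ i) t \<noteq> 0"
    and "proper_param p q"
    and "non_planar (rat_curve p q) I"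
    and "t0 \<in> I" and "\<exists>t\<in>I. t0 < t"
  shows "\<exists>t1\<in>I. t0 < t1 \<and> quasi_cubic (rat_curve p q) I t0 t1"
proof -
  obtain \<tau> where later: "\<tau> \<in> I" "t0 < \<tau>" using assms(6) by blast
  have in_I: "t \<in> I" if "t0 \<le> t" "t \<le> \<tau>" for t
    using assms(1,5) later that unfolding is_interval_1 by blast
  have "\<forall>\<^sub>F t1 in at_right t0. t0 < t1 \<and> t1 < \<tau>"
    using later(2) by (rule eventually_at_right_real[unfolded greaterThanLessThan_iff])
  then have "\<forall>\<^sub>F t1 in at_right t0. t1 \<in> I \<and> t0 < t1 \<and> quasi_cubic (rat_curve p q) I t0 t1"
    using eventually_no_double_point[OF assms(3,2)] eventually_quasi_cubic[OF assms(2,4,5)]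
  proof eventually_elim
    case (elim t1)
    then show ?case using in_I by simp
  qed
  then show ?thesis using eventually_happens'[OF trivial_limit_at_right_real] by blast
qed

end
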